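(* There is a universal constant $c>0$ such that for any $M,K,R\ge1$, $H,B>0$ and $\sigma\ge0$, either Minibatch AC-SA or Single-Machine AC-SA (with suitably chosen parameters, in the homogeneous intermittent communication setting) guarantees that for any $F_0\in\mathcal{F}_0(H,B)$ $$\mathbb{E}F_0(\hat x)-F_0^*\le c\cdot\min\left\{\frac{HB^2}{(KR)^2}+\frac{\sigma B}{\sqrt{KR}},\ \frac{HB^2}{R^2}+\frac{\sigma B}{\sqrt{MKR}},\ HB^2\right\}.$$
   Context: $\mathcal{F}_0(H,B)$: convex, $H$-smooth (gradient $H$-Lipschitz) functions $F:\mathbb{R}^d\to\mathbb{R}$, $d\in\mathbb N$, with a minimizer $x^*$, $\|x^*\|\le B$. $F^*=\min F$. Homogeneous intermittent communication setting: $M$ machines, $R$ rounds of communication, $K$ oracle queries per machine per round. Each query at $x$ returns an independent stochastic gradient with mean $\nabla F(x)$ and variance $\mathbb{E}\|\cdot-\nabla F(x)\|^2\le\sigma^2$. AC-SA with $T$ iterations and stochastic gradients $g_t(\cdot)$: $x^{\mathrm{ag}}_0=x_0=0$; for $t=0,\dots,T-1$: $x^{\mathrm{md}}_{t+1}=\beta_t^{-1}x_t+(1-\beta_t^{-1})x^{\mathrm{ag}}_t$; $x_{t+1}=x_t-\gamma_t\,g_t(x^{\mathrm{md}}_{t+1})$; $x^{\mathrm{ag}}_{t+1}=\beta_t^{-1}x_{t+1}+(1-\beta_t^{-1})x^{\mathrm{ag}}_t$; output $\hat x=x^{\mathrm{ag}}_T$. The parameters $\beta_t\ge1$, $\gamma_t\ge0$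 may depend on $H,B,\sigma,M,K,R$. Minibatch AC-SA: $T=R$ iterations, where each $g_t$ is the average of the $MK$ stochastic gradients computed by all machines in one round at the same point. Single-Machine AC-SA: $T=KR$ iterations with single stochastic gradients, run on one machine, ignoring the others. *)

theory Defs
  imports "HOL-Probability.Probability" "HOL-Library.Poly_Mapping"
begin

section \<open>Euclidean spaces of arbitrary dimension\<close>

text \<open>
  The dimension has to be quantified inside the statement: neither the universal constant nor the
  parameters of the algorithms may depend on it. So \<open>\<real>\<^sup>d\<close> cannot be a type that varies with \<open>d\<close>;
  it is the subspace \<open>euclid d\<close> of the finitely supported real sequences, consisting of the
  sequences supported on \<open>{..<d}\<close>, with the Euclidean inner product. In this way inner
  product, norm, derivative, convexity and Borel sets are those of the library.
\<close>

abbreviation keys :: "('a \<Rightarrow>\<^sub>0 'b::zero) \<Rightarrow> 'a set" where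
  "keys \<equiv> Poly_Mapping.keys"

abbreviation lookup :: "('a \<Rightarrow>\<^sub>0 'b::zero) \<Rightarrow> 'a \<Rightarrow> 'b" where
  "lookup \<equiv> Poly_Mapping.lookup"

instantiation poly_mapping :: (type, real_inner) real_inner
begin

lift_definition scaleR_poly_mapping :: "real \<Rightarrow> ('a \<Rightarrow>\<^sub>0 'b) \<Rightarrow> ('a \<Rightarrow>\<^sub>0 'b)"
  is "\<lambda>r f i. r *\<^sub>R f i"
  by (erule rev_finite_subset) auto

definition inner_poly_mapping :: "('a \<Rightarrow>\<^sub>0 'b) \<Rightarrow> ('a \<Rightarrow>\<^sub>0 'b) \<Rightarrow> real" where
  "inner_poly_mapping x y = (\<Sum>i\<in>keys x. lookup x i \<bullet> lookup y i)"

definition norm_poly_mapping :: "('a \<Rightarrow>\<^sub>0 'b) \<Rightarrow> real" where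
  "norm_poly_mapping x = sqrt (x \<bullet> x)"

definition sgn_poly_mapping :: "('a \<Rightarrow>\<^sub>0 'b) \<Rightarrow> ('a \<Rightarrow>\<^sub>0 'b)" where
  "sgn_poly_mapping x = scaleR (inverse (norm x)) x"

definition dist_poly_mapping :: "('a \<Rightarrow>\<^sub>0 'b) \<Rightarrow> ('a \<Rightarrow>\<^sub>0 'b) \<Rightarrow> real" where
  "dist_poly_mapping x y = norm (x - y)"

definition uniformity_poly_mapping :: "(('a \<Rightarrow>\<^sub>0 'b) \<times> ('a \<Rightarrow>\<^sub>0 'b)) filter" where
  "uniformity_poly_mapping = (INF e\<in>{0 <..}. principal {(x, y). dist x y < e})"

definition open_poly_mapping :: "('a \<Rightarrow>\<^sub>0 'b) set \<Rightarrow> bool" where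
  "open_poly_mapping U \<longleftrightarrow> (\<forall>x\<in>U. eventually (\<lambda>(x', y). x' = x \<longrightarrow> y \<in> U) uniformity)"

lemma inner_poly_mapping_superset:
  fixes x y :: "'a \<Rightarrow>\<^sub>0 'b"
  assumes "finite A" "keys x \<subseteq> A"
  shows "x \<bullet> y = (\<Sum>i\<in>A. lookup x i \<bullet> lookup y i)"
  unfolding inner_poly_mapping_def
  by (rule sum.mono_neutral_left) (use assms in \<open>auto simp: in_keys_iff\<close>)

instance
proof
  fix x y z :: "'a \<Rightarrow>\<^sub>0 'b" and r s :: real
  show "r *\<^sub>R (x + y) = r *\<^sub>R x + r *\<^sub>R y"
    by (transfer) (auto simp: fun_eq_iff scaleR_right_distrib)
  show "(r + s) *\<^sub>R x = r *\<^sub>R x + s *\<^sub>R x"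
    by (transfer) (auto simp: fun_eq_iff scaleR_left_distrib)
  show "r *\<^sub>R s *\<^sub>R x = (r * s) *\<^sub>R x"
    by (transfer) auto
  show "1 *\<^sub>R x = x"
    by (transfer) auto
  let ?A = "keys x \<union> keys y"
  have "x \<bullet> y = (\<Sum>i\<in>?A. lookup x i \<bullet> lookup y i)"
    by (rule inner_poly_mapping_superset) auto
  also have "\<dots> = (\<Sum>i\<in>?A. lookup y i \<bullet> lookup x i)"
    by (rule sum.cong) (rule refl, rule inner_commute)
  also have "\<dots> = y \<bullet> x"
    by (rule inner_poly_mapping_superset[symmetric]) auto
  finally show "x \<bullet> y = y \<bullet> x" .
  have "(x + y) \<bullet> z = (\<Sum>i\<in>?A. lookup (x + y) i \<bullet> lookup z i)"
    by (rule inner_poly_mapping_superset) (auto simp: in_keys_iff lookup_add)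
  also have "\<dots> = (\<Sum>i\<in>?A. lookup x i \<bullet> lookup z i) + (\<Sum>i\<in>?A. lookup y i \<bullet> lookup z i)"
    by (simp add: lookup_add inner_add_left sum.distrib)
  also have "(\<Sum>i\<in>?A. lookup x i \<bullet> lookup z i) = x \<bullet> z"
    by (rule inner_poly_mapping_superset[symmetric]) auto
  also have "(\<Sum>i\<in>?A. lookup y i \<bullet> lookup z i) = y \<bullet> z"
    by (rule inner_poly_mapping_superset[symmetric]) auto
  finally show "(x + y) \<bullet> z = x \<bullet> z + y \<bullet> z" .
  have "(r *\<^sub>R x) \<bullet> y = (\<Sum>i\<in>keys x. lookup (r *\<^sub>R x) i \<bullet> lookup y i)"
    by (rule inner_poly_mapping_superset) (auto simp: in_keys_iff scaleR_poly_mapping.rep_eq)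
  then show "(r *\<^sub>R x) \<bullet> y = r * (x \<bullet> y)"
    by (simp add: inner_poly_mapping_def scaleR_poly_mapping.rep_eq sum_distrib_left)
  show "0 \<le> x \<bullet> x"
    by (simp add: inner_poly_mapping_def sum_nonneg)
  have "x \<bullet> x = 0 \<longleftrightarrow> (\<forall>i\<in>keys x. lookup x i = 0)"
    by (simp add: inner_poly_mapping_def sum_nonneg_eq_0_iff)
  also have "\<dots> \<longleftrightarrow> x = 0"
    by (metis in_keys_iff lookup_zero poly_mapping_eqI)
  finally show "x \<bullet> x = 0 \<longleftrightarrow> x = 0" .
qed (rule norm_poly_mapping_def sgn_poly_mapping_def dist_poly_mapping_def
      uniformity_poly_mapping_def open_poly_mapping_def)+

end

type_synonym vect = "nat \<Rightarrow>\<^sub>0 real"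

definition euclid :: "nat \<Rightarrow> vect set" where
  "euclid d = {x. keys x \<subseteq> {..<d}}"

lemma inner_euclid: "x \<in> euclid d \<Longrightarrow> x \<bullet> y = (\<Sum>i<d. lookup x i * lookup y i)"
  by (simp add: inner_poly_mapping_superset[of "{..<d}"] euclid_def)

lemma norm_euclid: "x \<in> euclid d \<Longrightarrow> norm x = sqrt (\<Sum>i<d. (lookup x i)\<^sup>2)"
  by (simp add: norm_eq_sqrt_inner inner_euclid power2_eq_square)

lemma euclid_subspace: "subspace (euclid d)"
  by (auto simp: subspace_def euclid_def in_keys_iff lookup_add scaleR_poly_mapping.rep_eq subset_iff) (metis add_0)

definition borel_euclid :: "nat \<Rightarrow> vect measure" where
  "borel_euclid d = restrict_space borel (euclid d)"


section \<open>Smooth convex objectives\<close>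

text \<open>An objective on \<open>\<real>\<^sup>d\<close> is a function on \<open>vect\<close>, of which only the restriction to
  \<open>euclid d\<close> is ever used.\<close>

definition has_gradient :: "nat \<Rightarrow> (vect \<Rightarrow> real) \<Rightarrow> vect \<Rightarrow> vect \<Rightarrow> bool" where
  "has_gradient d F x g \<longleftrightarrow>
     g \<in> euclid d \<and> (F has_derivative (\<lambda>h. g \<bullet> h)) (at x within euclid d)"

definition gradient :: "nat \<Rightarrow> (vect \<Rightarrow> real) \<Rightarrow> vect \<Rightarrow> vect" where
  "gradient d F x = (THE g. has_gradient d F x g)"

lemma has_gradient_unique:
  assumes x: "x \<in> euclid d" and g: "has_gradient d F x g" and g': "has_gradient d F x g'"
  shows "g = g'"
proof -
  define h where "h = g - g'"
  have h: "h \<in> euclid d"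
    using g g' by (auto simp: h_def has_gradient_def intro: subspace_diff euclid_subspace)
  have line: "x + t *\<^sub>R h \<in> euclid d" for t
    using x h by (intro subspace_add subspace_scale euclid_subspace)
  have D: "((\<lambda>t. F (x + t *\<^sub>R h)) has_real_derivative (k \<bullet> h)) (at 0)" if "has_gradient d F x k" for k
  proof -
    have 1: "((\<lambda>t. x + t *\<^sub>R h) has_derivative (\<lambda>t. t *\<^sub>R h)) (at 0 within UNIV)"
      by (auto intro!: derivative_eq_intros)
    have "(F has_derivative (\<lambda>h. k \<bullet> h)) (at (x + 0 *\<^sub>R h) within euclid d)"
      using that by (simp add: has_gradient_def)
    then have 2: "(F has_derivative (\<lambda>h. k \<bullet> h)) (at (x + 0 *\<^sub>R h) within range (\<lambda>t. x + t *\<^sub>R h))"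
      by (rule has_derivative_subset) (use line in auto)
    show ?thesis
      using has_derivative_in_compose[OF 1 2]
      by (simp add: has_field_derivative_def mult.commute[of _ "k \<bullet> h"])
  qed
  have "g \<bullet> h = g' \<bullet> h"
    using DERIV_unique[OF D[OF g] D[OF g']] .
  then have "h \<bullet> h = 0" by (simp add: h_def inner_diff_left)
  then show ?thesis by (simp add: h_def)
qed

lemma gradient_eqI: "x \<in> euclid d \<Longrightarrow> has_gradient d F x g \<Longrightarrow> gradient d F x = g"
  unfolding gradient_def by (rule the_equality) (auto intro: has_gradient_unique)

definition smooth :: "nat \<Rightarrow> real \<Rightarrow> (vect \<Rightarrow> real) \<Rightarrow> bool" where
  "smooth d H F \<longleftrightarrow>
     (\<forall>x\<in>euclid d. \<exists>g. has_gradient d F x g) \<and> H-lipschitz_on (euclid d) (gradient d F)"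

definition objectives :: "nat \<Rightarrow> real \<Rightarrow> real \<Rightarrow> (vect \<Rightarrow> real) set" where
  "objectives d H B = {F. convex_on (euclid d) F \<and> smooth d H F \<and>
     (\<exists>xmin\<in>euclid d. (\<forall>x\<in>euclid d. F xmin \<le> F x) \<and> norm xmin \<le> B)}"

definition min_value :: "nat \<Rightarrow> (vect \<Rightarrow> real) \<Rightarrow> real" where
  "min_value d F = (INF x\<in>euclid d. F x)"


section \<open>Stochastic gradient oracles\<close>

text \<open>An oracle is a Markov kernel: \<open>Q x\<close> is the distribution of the answer to a query at \<open>x\<close>,
  which is drawn afresh for each query. The mean is taken coordinatewise.\<close>

definition gradient_oracle ::
    "nat \<Rightarrow> (vect \<Rightarrow> real) \<Rightarrow> real \<Rightarrow> (vect \<Rightarrow> vect measure) \<Rightarrow> bool" where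
  "gradient_oracle d F \<sigma> Q \<longleftrightarrow>
     Q \<in> borel_euclid d \<rightarrow>\<^sub>M prob_algebra (borel_euclid d) \<and>
     (\<forall>x\<in>euclid d.
        (\<forall>i<d. integrable (Q x) (\<lambda>g. lookup g i) \<and>
               (\<integral>g. lookup g i \<partial>Q x) = lookup (gradient d F x) i) \<and>
        (\<integral>\<^sup>+g. ennreal ((norm (g - gradient d F x))\<^sup>2) \<partial>Q x) \<le> ennreal (\<sigma>\<^sup>2))"

text \<open>\<open>Q r m k\<close> answers query \<open>k\<close> of machine \<open>m\<close> in round \<open>r\<close>. All queries
  concern the same objective (homogeneous setting); the noise need not be identically distributed
  across queries.\<close>

type_synonym oracles = "nat \<Rightarrow> nat \<Rightarrow> nat \<Rightarrow> vect \<Rightarrow> vect measure"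

definition oracles_for :: "nat \<Rightarrow> (vect \<Rightarrow> real) \<Rightarrow> real \<Rightarrow> oracles \<Rightarrow> bool" where
  "oracles_for d F \<sigma> Q \<longleftrightarrow> (\<forall>r m k. gradient_oracle d F \<sigma> (Q r m k))"


section \<open>AC-SA\<close>

definition acsa_query :: "(nat \<Rightarrow> real) \<Rightarrow> nat \<Rightarrow> vect \<times> vect \<Rightarrow> vect" where
  "acsa_query \<beta> t = (\<lambda>(x, xag). inverse (\<beta> t) *\<^sub>R x + (1 - inverse (\<beta> t)) *\<^sub>R xag)"

definition acsa_update ::
    "(nat \<Rightarrow> real) \<Rightarrow> (nat \<Rightarrow> real) \<Rightarrow> nat \<Rightarrow> vect \<times> vect \<Rightarrow> vect \<Rightarrow> vect \<times> vect" where
  "acsa_update \<beta> \<gamma> t = (\<lambda>(x, xag) g.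
     let x' = x - \<gamma> t *\<^sub>R g in (x', inverse (\<beta> t) *\<^sub>R x' + (1 - inverse (\<beta> t)) *\<^sub>R xag))"

text \<open>The joint law of the state \<open>(x\<^sub>t, x\<^sup>a\<^sup>g\<^sub>t)\<close>, where \<open>G t y\<close> is the law of the stochastic
  gradient used in iteration \<open>t\<close> if it is evaluated at \<open>y\<close>.\<close>

primrec acsa_state ::
    "nat \<Rightarrow> (nat \<Rightarrow> real) \<Rightarrow> (nat \<Rightarrow> real) \<Rightarrow> (nat \<Rightarrow> vect \<Rightarrow> vect measure) \<Rightarrow> nat \<Rightarrow>
     (vect \<times> vect) measure" where
  "acsa_state d \<beta> \<gamma> G 0 = return (borel_euclid d \<Otimes>\<^sub>M borel_euclid d) (0, 0)"
| "acsa_state d \<beta> \<gamma> G (Suc t) = acsa_state d \<beta> \<gamma> G t \<bind>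
     (\<lambda>s. distr (G t (acsa_query \<beta> t s)) (borel_euclid d \<Otimes>\<^sub>M borel_euclid d)
            (acsa_update \<beta> \<gamma> t s))"

definition acsa ::
    "nat \<Rightarrow> (nat \<Rightarrow> real) \<Rightarrow> (nat \<Rightarrow> real) \<Rightarrow> (nat \<Rightarrow> vect \<Rightarrow> vect measure) \<Rightarrow> nat \<Rightarrow>
     vect measure" where
  "acsa d \<beta> \<gamma> G T = distr (acsa_state d \<beta> \<gamma> G T) (borel_euclid d) snd"

definition acsa_parameters :: "(nat \<Rightarrow> real) \<Rightarrow> (nat \<Rightarrow> real) \<Rightarrow> bool" where
  "acsa_parameters \<beta> \<gamma> \<longleftrightarrow> (\<forall>t. \<beta> t \<ge> 1 \<and> \<gamma> t \<ge> 0)"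

definition round_average ::
    "nat \<Rightarrow> nat \<Rightarrow> nat \<Rightarrow> oracles \<Rightarrow> nat \<Rightarrow> vect \<Rightarrow> vect measure" where
  "round_average d M K Q r y =
     distr (\<Pi>\<^sub>M (m, k)\<in>{..<M} \<times> {..<K}. Q r m k y) (borel_euclid d)
       (\<lambda>g. (1 / real (M * K)) *\<^sub>R (\<Sum>q\<in>{..<M} \<times> {..<K}. g q))"

definition minibatch_acsa ::
    "nat \<Rightarrow> nat \<Rightarrow> nat \<Rightarrow> (nat \<Rightarrow> real) \<Rightarrow> (nat \<Rightarrow> real) \<Rightarrow> nat \<Rightarrow> oracles \<Rightarrow> vect measure" where
  "minibatch_acsa M K R \<beta> \<gamma> d Q = acsa d \<beta> \<gamma> (round_average d M K Q) R"

text \<open>Iteration \<open>t\<close> is query \<open>t mod K\<close> of round \<open>t div K\<close>, on machine \<open>0\<close>.\<close>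

definition single_machine_acsa ::
    "nat \<Rightarrow> nat \<Rightarrow> (nat \<Rightarrow> real) \<Rightarrow> (nat \<Rightarrow> real) \<Rightarrow> nat \<Rightarrow> oracles \<Rightarrow> vect measure" where
  "single_machine_acsa K R \<beta> \<gamma> d Q = acsa d \<beta> \<gamma> (\<lambda>t. Q (t div K) 0 (t mod K)) (K * R)"

text \<open>An algorithm maps the dimension and the oracles to the law of its output.\<close>

definition guarantees ::
    "(nat \<Rightarrow> oracles \<Rightarrow> vect measure) \<Rightarrow> real \<Rightarrow> real \<Rightarrow> real \<Rightarrow> real \<Rightarrow> bool" where
  "guarantees A H B \<sigma> \<epsilon> \<longleftrightarrow>
     (\<forall>d. \<forall>F\<in>objectives d H B. \<forall>Q. oracles_for d F \<sigma> Q \<longrightarrow>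
        integrable (A d Q) F \<and> (\<integral>x. F x \<partial>A d Q) - min_value d F \<le> \<epsilon>)"

end

theory Submission
  imports Defs
begin

text \<open>
  With \<open>\<beta>\<^sub>t = (t + 2) / 2\<close>, \<open>\<gamma>\<^sub>t = \<eta> (t + 2) / 2\<close> and \<open>2 H \<eta> \<le> 1\<close>, the potential
  \<open>(t + 1)\<^sup>2 (F(x\<^sup>a\<^sup>g\<^sub>t) - F\<^sup>*) + (2 / \<eta>) \<parallel>x\<^sub>t - x\<^sup>*\<parallel>\<^sup>2\<close> grows in expectation by at most
  \<open>\<eta> (t + 2)\<^sup>2 \<sigma>\<^sup>2\<close> per iteration. For \<open>1 / \<eta> = 2 H + \<sigma> T\<^bsup>3/2\<^esup> / B\<close> this gives the error
  \<open>6 (H B\<^sup>2 / T\<^sup>2 + \<sigma> B / \<surd>T)\<close> after \<open>T\<close> iterations. Averaging the \<open>M K\<close> independent answers of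
  a round yields a stochastic gradient with \<open>\<sigma>\<^sup>2 / (M K)\<close> in place of \<open>\<sigma>\<^sup>2\<close>, so the first two terms
  of the minimum are the bounds for Single-Machine and Minibatch AC-SA. The third is attained by
  zero step sizes, which return the point \<open>0\<close>.
\<close>

section \<open>Measurability in Euclidean space\<close>

lemma lookup_scaleR [simp]: "lookup (r *\<^sub>R x) i = r *\<^sub>R lookup x i"
  by (simp add: scaleR_poly_mapping.rep_eq)

text \<open>Coordinates become inner products, so their continuity and the Cauchy-Schwarz bound come
  from the inner product structure.\<close>

lemma lookup_eq_inner_single: "lookup x i = x \<bullet> Poly_Mapping.single i (1::real)"
  by (subst inner_commute) (simp add: inner_poly_mapping_def)

lemma continuous_on_lookup: "continuous_on A (\<lambda>x. lookup x i :: real)"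
  unfolding lookup_eq_inner_single by (intro continuous_intros)

lemma zero_in_euclid [simp]: "0 \<in> euclid d"
  by (rule subspace_0[OF euclid_subspace])

lemma euclid_expansion:
  assumes "x \<in> euclid d"
  shows "(\<Sum>i<d. lookup x i *\<^sub>R Poly_Mapping.single i 1) = x"
proof (rule poly_mapping_eqI)
  fix k
  have "lookup (\<Sum>i<d. lookup x i *\<^sub>R Poly_Mapping.single i 1) k = (\<Sum>i<d. if i = k then lookup x k else 0)"
    unfolding lookup_sum by (intro sum.cong) (auto simp: lookup_single when_def)
  also have "\<dots> = lookup x k"
    using assms by (auto simp: euclid_def in_keys_iff)
  finally show "lookup (\<Sum>i<d. lookup x i *\<^sub>R Poly_Mapping.single i 1) k = lookup x k" .
qed

lemma space_borel_euclid [simp]: "space (borel_euclid d) = euclid d"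
  by (simp add: borel_euclid_def space_restrict_space)

lemma measurable_lookup [measurable]: "(\<lambda>x. lookup x i) \<in> borel_measurable (borel_euclid d)"
  unfolding borel_euclid_def
  by (intro borel_measurable_continuous_on_restrict continuous_on_lookup)

text \<open>The type \<open>vect\<close> is not second countable, so the library's measurability rules for
  addition and scaling do not apply to it. Instead, the coordinates are collected in
  \<open>nat \<Rightarrow> real\<close>, whose Borel sets are the product ones, and mapped back continuously.\<close>

lemma measurable_borel_euclidI:
  assumes f: "f \<in> space M \<rightarrow> euclid d"
    and [measurable]: "\<And>i. i < d \<Longrightarrow> (\<lambda>x. lookup (f x) i) \<in> borel_measurable M"
  shows "f \<in> M \<rightarrow>\<^sub>M borel_euclid d"
proof -
  define \<phi> where "\<phi> c = (\<Sum>i<d. c i *\<^sub>R Poly_Mapping.single i (1::real))" for c :: "nat \<Rightarrow> real"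
  have "continuous_on UNIV \<phi>"
    unfolding \<phi>_def by (intro continuous_intros continuous_on_product_coordinates)
  then have \<phi>: "\<phi> \<in> borel_measurable borel"
    by (rule borel_measurable_continuous_onI)
  \<comment> \<open>Coordinates from \<open>d\<close> on are set to 0, since measurability is
    assumed only below \<open>d\<close> while the product space asks for every index.\<close>
  have "(\<lambda>x i. if i < d then lookup (f x) i else 0) \<in> borel_measurable M"
  proof (rule measurable_coordinatewise_then_product)
    show "(\<lambda>x. if i < d then lookup (f x) i else 0) \<in> borel_measurable M" for i
      by (cases "i < d") auto
  qed
  from measurable_compose[OF this \<phi>]
  have "(\<lambda>x. \<phi> (\<lambda>i. if i < d then lookup (f x) i else 0)) \<in> borel_measurable M" .
  also have "?this \<longleftrightarrow> f \<in> borel_measurable M"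
    by (rule measurable_cong) (use f euclid_expansion in \<open>auto simp: \<phi>_def\<close>)
  finally show ?thesis
    unfolding borel_euclid_def using f by (simp add: measurable_restrict_space2_iff)
qed

lemma measurable_scaleR_euclid [measurable (raw)]:
  assumes "f \<in> M \<rightarrow>\<^sub>M borel_euclid d"
  shows "(\<lambda>x. c *\<^sub>R f x) \<in> M \<rightarrow>\<^sub>M borel_euclid d"
proof -
  note [measurable] = measurable_compose[OF assms measurable_lookup]
  show ?thesis
    using measurable_space[OF assms]
    by (intro measurable_borel_euclidI) (auto intro: subspace_scale euclid_subspace)
qed

lemma measurable_add_euclid [measurable (raw)]:
  assumes "f \<in> M \<rightarrow>\<^sub>M borel_euclid d" "g \<in> M \<rightarrow>\<^sub>M borel_euclid d"
  shows "(\<lambda>x. f x + g x) \<in> M \<rightarrow>\<^sub>M borel_euclid d"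
proof -
  note [measurable] = assms[THEN measurable_compose[OF _ measurable_lookup]]
  show ?thesis
    using assms[THEN measurable_space]
    by (intro measurable_borel_euclidI) (auto intro: subspace_add euclid_subspace simp: lookup_add)
qed

lemma measurable_diff_euclid [measurable (raw)]:
  assumes "f \<in> M \<rightarrow>\<^sub>M borel_euclid d" "g \<in> M \<rightarrow>\<^sub>M borel_euclid d"
  shows "(\<lambda>x. f x - g x) \<in> M \<rightarrow>\<^sub>M borel_euclid d"
  using measurable_add_euclid[OF assms(1) measurable_scaleR_euclid[OF assms(2), of "-1"]] by simp

lemma measurable_sum_euclid:
  assumes "\<And>i. i \<in> I \<Longrightarrow> f i \<in> M \<rightarrow>\<^sub>M borel_euclid d"
  shows "(\<lambda>x. \<Sum>i\<in>I. f i x) \<in> M \<rightarrow>\<^sub>M borel_euclid d"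
  using assms
  by (induction I rule: infinite_finite_induct) auto

lemma continuous_on_imp_measurable_borel_euclid:
  "continuous_on (euclid d) f \<Longrightarrow> f \<in> borel_measurable (borel_euclid d)"
  unfolding borel_euclid_def by (rule borel_measurable_continuous_on_restrict)

section \<open>Smooth convex functions\<close>

lemma smooth_has_gradient:
  assumes "smooth d H F" "x \<in> euclid d"
  shows "has_gradient d F x (gradient d F x)"
  using assms gradient_eqI unfolding smooth_def by fastforce

lemma gradient_in_euclid: "smooth d H F \<Longrightarrow> x \<in> euclid d \<Longrightarrow> gradient d F x \<in> euclid d"
  using smooth_has_gradient by (auto simp: has_gradient_def)

lemma smooth_continuous_on: "smooth d H F \<Longrightarrow> continuous_on (euclid d) F"
  unfolding continuous_on_eq_continuous_within
  using smooth_has_gradient has_derivative_continuous unfolding has_gradient_def by blast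

text \<open>The whole line stays in the subspace, so the derivative within \<open>euclid d\<close>
  composes with it to an ordinary two-sided derivative. This reduces the inequalities below to one
  real variable.\<close>

lemma smooth_line_derivative:
  assumes F: "smooth d H F" and x: "x \<in> euclid d" and h: "h \<in> euclid d"
  shows "((\<lambda>t. F (x + t *\<^sub>R h)) has_real_derivative (gradient d F (x + t *\<^sub>R h) \<bullet> h)) (at t)"
proof -
  have line: "x + t *\<^sub>R h \<in> euclid d" for t
    using x h by (intro subspace_add subspace_scale euclid_subspace)
  have 1: "((\<lambda>t. x + t *\<^sub>R h) has_derivative (\<lambda>t. t *\<^sub>R h)) (at t within UNIV)"
    by (auto intro!: derivative_eq_intros)
  have "(F has_derivative (\<lambda>k. gradient d F (x + t *\<^sub>R h) \<bullet> k)) (at (x + t *\<^sub>R h) within euclid d)"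
    using smooth_has_gradient[OF F line] by (simp add: has_gradient_def)
  then have 2: "(F has_derivative (\<lambda>k. gradient d F (x + t *\<^sub>R h) \<bullet> k))
      (at (x + t *\<^sub>R h) within range (\<lambda>t. x + t *\<^sub>R h))"
    by (rule has_derivative_subset) (use line in auto)
  show ?thesis
    using has_derivative_in_compose[OF 1 2]
    by (simp add: has_field_derivative_def mult.commute[of _ "gradient d F (x + t *\<^sub>R h) \<bullet> h"])
qed

text \<open>Descent lemma. \<open>\<psi>\<close> is \<open>F\<close> along the segment minus the
  linear and quadratic terms of the bound; it decreases on [0, 1] by Cauchy-Schwarz and the
  Lipschitz gradient.\<close>

lemma smooth_upper_bound:
  assumes F: "smooth d H F" and x: "x \<in> euclid d" and y: "y \<in> euclid d"
  shows "F y \<le> F x + gradient d F x \<bullet> (y - x) + H / 2 * (norm (y - x))\<^sup>2"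
proof -
  define h where "h = y - x"
  define \<psi> where "\<psi> t = F (x + t *\<^sub>R h) - t * (gradient d F x \<bullet> h) - H / 2 * (norm h)\<^sup>2 * t\<^sup>2" for t
  have h: "h \<in> euclid d"
    using x y by (auto simp: h_def intro: subspace_diff euclid_subspace)
  have line: "x + t *\<^sub>R h \<in> euclid d" for t
    using x h by (intro subspace_add subspace_scale euclid_subspace)
  have "\<psi> 1 \<le> \<psi> 0"
  proof (rule DERIV_nonpos_imp_nonincreasing[of 0 1 \<psi>])
    fix t :: real assume t: "0 \<le> t" "t \<le> 1"
    define D where "D = gradient d F (x + t *\<^sub>R h) - gradient d F x"
    have "(\<psi> has_real_derivative (D \<bullet> h - H * (norm h)\<^sup>2 * t)) (at t)"
      unfolding \<psi>_def D_def
      by (auto intro!: derivative_eq_intros smooth_line_derivative[OF F x h] simp: inner_diff_left)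
    moreover have "norm D \<le> H * norm (t *\<^sub>R h)"
      using F lipschitz_onD[of H "euclid d" "gradient d F" "x + t *\<^sub>R h" x] x line
      by (auto simp: D_def smooth_def dist_norm)
    then have "norm D * norm h \<le> H * norm (t *\<^sub>R h) * norm h"
      by (intro mult_right_mono) auto
    then have "D \<bullet> h \<le> H * (norm h)\<^sup>2 * t"
      using norm_cauchy_schwarz[of D h] t by (simp add: power2_eq_square mult_ac)
    ultimately show "\<exists>y. (\<psi> has_real_derivative y) (at t) \<and> y \<le> 0"
      by force
  qed simp
  then show ?thesis
    by (simp add: \<psi>_def h_def)
qed

text \<open>On the line through both points, \<open>F\<close> is a convex function of one real
  variable and lies above its tangent at 0.\<close>

lemma convex_lower_bound:
  assumes F: "smooth d H F" and conv: "convex_on (euclid d) F"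
    and x: "x \<in> euclid d" and y: "y \<in> euclid d"
  shows "F x + gradient d F x \<bullet> (y - x) \<le> F y"
proof -
  define h where "h = y - x"
  have h: "h \<in> euclid d"
    using x y by (auto simp: h_def intro: subspace_diff euclid_subspace)
  have line: "x + t *\<^sub>R h \<in> euclid d" for t
    using x h by (intro subspace_add subspace_scale euclid_subspace)
  have "convex_on UNIV (\<lambda>t. F (x + t *\<^sub>R h))"
  proof (rule convex_onI)
    fix t a b :: real assume t: "0 < t" "t < 1"
    have *: "x + ((1 - t) *\<^sub>R a + t *\<^sub>R b) *\<^sub>R h = (1 - t) *\<^sub>R (x + a *\<^sub>R h) + t *\<^sub>R (x + b *\<^sub>R h)"
      by (simp add: algebra_simps)
    show "F (x + ((1 - t) *\<^sub>R a + t *\<^sub>R b) *\<^sub>R h) \<le> (1 - t) * F (x + a *\<^sub>R h) + t * F (x + b *\<^sub>R h)"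
      unfolding * by (rule convex_onD[OF conv]) (use t line in auto)
  qed simp
  then have "(gradient d F (x + 0 *\<^sub>R h) \<bullet> h) * (1 - 0) \<le> F (x + 1 *\<^sub>R h) - F (x + 0 *\<^sub>R h)"
    by (rule convex_on_imp_above_tangent)
      (use smooth_line_derivative[OF F x h, of 0] in auto)
  then show ?thesis
    by (simp add: h_def)
qed

text \<open>From \<open>u\<close> in the direction of the gradient itself, the derivative of
  \<open>F\<close> is the squared norm of the gradient; at a minimum it is 0.\<close>

lemma gradient_at_minimum:
  assumes F: "smooth d H F" and u: "u \<in> euclid d" and min: "\<And>x. x \<in> euclid d \<Longrightarrow> F u \<le> F x"
  shows "gradient d F u = 0"
proof -
  let ?h = "gradient d F u"
  have h: "?h \<in> euclid d"
    by (rule gradient_in_euclid[OF F u])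
  have "u + t *\<^sub>R ?h \<in> euclid d" for t
    using u h by (intro subspace_add subspace_scale euclid_subspace)
  then have "gradient d F (u + 0 *\<^sub>R ?h) \<bullet> ?h = 0"
    by (intro DERIV_local_min[OF smooth_line_derivative[OF F u h], of 1]) (auto intro: min)
  then show ?thesis by simp
qed

text \<open>Controls the initial gap \<open>F 0 - F u\<close>: at a minimizer the linear term of the
  descent lemma vanishes.\<close>

lemma smooth_minimum_gap:
  assumes F: "smooth d H F" and u: "u \<in> euclid d" and min: "\<And>x. x \<in> euclid d \<Longrightarrow> F u \<le> F x"
    and x: "x \<in> euclid d"
  shows "F x - F u \<le> H / 2 * (norm (x - u))\<^sup>2"
  using smooth_upper_bound[OF F u x] gradient_at_minimum[OF F u min] by simp

lemma min_value_eq: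
  assumes "u \<in> euclid d" "\<And>x. x \<in> euclid d \<Longrightarrow> F u \<le> F x"
  shows "min_value d F = F u"
  unfolding min_value_def
  by (intro antisym cINF_lower cINF_greatest bdd_belowI[of _ "F u"]) (use assms in auto)

section \<open>Stochastic gradients\<close>

lemma gradient_oracle_kernel:
  "gradient_oracle d F \<sigma> Q \<Longrightarrow> Q \<in> borel_euclid d \<rightarrow>\<^sub>M prob_algebra (borel_euclid d)"
  by (simp add: gradient_oracle_def)

lemma gradient_oracle_prob_space:
  assumes "gradient_oracle d F \<sigma> Q" "y \<in> euclid d"
  shows "prob_space (Q y)" "sets (Q y) = sets (borel_euclid d)"
  using measurable_space[OF gradient_oracle_kernel[OF assms(1)], of y] assms(2)
  by (auto simp: space_prob_algebra)

text \<open>A finite nonnegative integral of a measurable function yields Bochner integrability, so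
  the variance bound can enter real-valued linear calculations.\<close>

lemma gradient_oracle_variance:
  assumes Q: "gradient_oracle d F \<sigma> Q" and y: "y \<in> euclid d"
  shows "integrable (Q y) (\<lambda>g. (norm (g - gradient d F y))\<^sup>2)"
    and "(\<integral>g. (norm (g - gradient d F y))\<^sup>2 \<partial>Q y) \<le> \<sigma>\<^sup>2"
proof -
  let ?f = "\<lambda>g. (norm (g - gradient d F y))\<^sup>2"
  have meas: "?f \<in> borel_measurable (Q y)"
    unfolding measurable_cong_sets[OF gradient_oracle_prob_space(2)[OF Q y] refl]
    by (intro continuous_on_imp_measurable_borel_euclid continuous_intros)
  have le: "(\<integral>\<^sup>+g. ennreal (?f g) \<partial>Q y) \<le> ennreal (\<sigma>\<^sup>2)"
    using Q y by (simp add: gradient_oracle_def)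
  also have "\<dots> < \<infinity>" by simp
  finally show int: "integrable (Q y) ?f"
    using meas by (intro integrableI_bounded) auto
  show "(\<integral>g. ?f g \<partial>Q y) \<le> \<sigma>\<^sup>2"
    using le by (subst (asm) nn_integral_eq_integral[OF int]) (auto simp: ennreal_le_iff)
qed

lemma gradient_oracle_unbiased:
  assumes Q: "gradient_oracle d F \<sigma> Q" and y: "y \<in> euclid d" and v: "v \<in> euclid d"
  shows "integrable (Q y) (\<lambda>g. (g - gradient d F y) \<bullet> v)"
    and "(\<integral>g. (g - gradient d F y) \<bullet> v \<partial>Q y) = 0"
proof -
  interpret prob_space "Q y" by (rule gradient_oracle_prob_space[OF Q y])
  have coord: "integrable (Q y) (\<lambda>g. lookup g i)"
    "(\<integral>g. lookup g i \<partial>Q y) = lookup (gradient d F y) i" if "i < d" for i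
    using Q y that by (auto simp: gradient_oracle_def)
  \<comment> \<open>Expanding along \<open>v\<close>, which lies in \<open>euclid d\<close>, gives
    the identity for every \<open>g\<close>.\<close>
  have eq: "(g - gradient d F y) \<bullet> v = (\<Sum>i<d. (lookup g i - lookup (gradient d F y) i) * lookup v i)" for g
    by (subst inner_commute, subst inner_euclid[OF v]) (simp add: lookup_minus mult.commute)
  show "integrable (Q y) (\<lambda>g. (g - gradient d F y) \<bullet> v)"
    unfolding eq by (intro Bochner_Integration.integrable_sum integrable_mult_left
        Bochner_Integration.integrable_diff coord) auto
  show "(\<integral>g. (g - gradient d F y) \<bullet> v \<partial>Q y) = 0"
    unfolding eq
    by (subst Bochner_Integration.integral_sum)
      (auto intro!: Bochner_Integration.integrable_sum integrable_mult_left
        Bochner_Integration.integrable_diff coord sum.neutral simp: coord prob_space)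
qed

text \<open>The linear noise term has mean 0 and the quadratic one is bounded by the variance.
  Nonnegativity of \<open>\<Phi>\<close> passes to the majorant, whose nonnegative integral is
  therefore its Bochner integral.\<close>

lemma gradient_oracle_nn_integral_le:
  assumes Q: "gradient_oracle d F \<sigma> Q" and y: "y \<in> euclid d" and v: "v \<in> euclid d" and c: "0 \<le> c"
    and \<Phi>: "\<And>g. g \<in> euclid d \<Longrightarrow> 0 \<le> \<Phi> g"
      "\<And>g. g \<in> euclid d \<Longrightarrow>
        \<Phi> g \<le> A - b * ((g - gradient d F y) \<bullet> v) + c * (norm (g - gradient d F y))\<^sup>2"
  shows "(\<integral>\<^sup>+g. ennreal (\<Phi> g) \<partial>Q y) \<le> ennreal (A + c * \<sigma>\<^sup>2)"
proof -
  interpret prob_space "Q y" by (rule gradient_oracle_prob_space[OF Q y])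
  have space: "space (Q y) = euclid d"
    using sets_eq_imp_space_eq[OF gradient_oracle_prob_space(2)[OF Q y]] by simp
  let ?h = "\<lambda>g. A - b * ((g - gradient d F y) \<bullet> v) + c * (norm (g - gradient d F y))\<^sup>2"
  have int: "integrable (Q y) ?h"
    by (intro Bochner_Integration.integrable_add Bochner_Integration.integrable_diff
        integrable_mult_right gradient_oracle_unbiased[OF Q y v] gradient_oracle_variance[OF Q y]) auto
  have "(\<integral>\<^sup>+g. ennreal (\<Phi> g) \<partial>Q y) \<le> (\<integral>\<^sup>+g. ennreal (?h g) \<partial>Q y)"
    using \<Phi> by (intro nn_integral_mono ennreal_leI) (auto simp: space)
  also have "\<dots> = ennreal (\<integral>g. ?h g \<partial>Q y)"
    by (rule nn_integral_eq_integral[OF int]) (use \<Phi> space in \<open>auto intro!: AE_I2 intro: order_trans\<close>)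
  also have "(\<integral>g. ?h g \<partial>Q y) = A + c * (\<integral>g. (norm (g - gradient d F y))\<^sup>2 \<partial>Q y)"
    using gradient_oracle_unbiased[OF Q y v] gradient_oracle_variance(1)[OF Q y]
    by (simp add: prob_space)
  also have "\<dots> \<le> A + c * \<sigma>\<^sup>2"
    using gradient_oracle_variance(2)[OF Q y] c by (intro add_left_mono mult_left_mono)
  finally show ?thesis by (simp add: ennreal_leI)
qed

section \<open>Products of kernels and averages of independent answers\<close>

text \<open>It suffices to check finite boxes, an intersection-stable generator on which the product
  measure is a product of measurable factors. This makes the law of a round average a Markov
  kernel.\<close>

lemma measurable_PiM_prob_algebra:
  assumes I: "finite I" and K: "\<And>i. i \<in> I \<Longrightarrow> K i \<in> M \<rightarrow>\<^sub>M prob_algebra (N i)"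
  shows "(\<lambda>x. \<Pi>\<^sub>M i\<in>I. K i x) \<in> M \<rightarrow>\<^sub>M prob_algebra (\<Pi>\<^sub>M i\<in>I. N i)"
proof (rule measurable_prob_algebra_generated[OF sets_PiM Int_stable_prod_algebra prod_algebra_sets_into_space])
  fix x assume x: "x \<in> space M"
  have P: "prob_space (K i x)" "sets (K i x) = sets (N i)" if "i \<in> I" for i
    using measurable_space[OF K[OF that] x] by (simp_all add: space_prob_algebra)
  show "prob_space (\<Pi>\<^sub>M i\<in>I. K i x)"
    by (intro prob_space_PiM P)
  show "sets (\<Pi>\<^sub>M i\<in>I. K i x) = sets (\<Pi>\<^sub>M i\<in>I. N i)"
    by (intro sets_PiM_cong P refl)
next
  fix A assume "A \<in> prod_algebra I N"
  then obtain X where A: "A = (\<Pi>\<^sub>E i\<in>I. X i)" and X: "\<And>i. i \<in> I \<Longrightarrow> X i \<in> sets (N i)"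
    unfolding prod_algebra_eq_finite[OF I] by auto
  have "emeasure (\<Pi>\<^sub>M i\<in>I. K i x) A = (\<Prod>i\<in>I. emeasure (K i x) (X i))" if x: "x \<in> space M" for x
  proof -
    have P: "prob_space (K i x)" "sets (K i x) = sets (N i)" if "i \<in> I" for i
      using measurable_space[OF K[OF that] x] by (simp_all add: space_prob_algebra)
    have "prod_emb I (\<lambda>i. K i x) I (Pi\<^sub>E I X) = A"
      unfolding A using X P(2) by (intro prod_emb_PiE_same_index) (metis sets.sets_into_space)
    then show ?thesis
      using emeasure_PiM_emb[of I "\<lambda>i. K i x" I X] P X I by simp
  qed
  moreover have "(\<lambda>x. \<Prod>i\<in>I. emeasure (K i x) (X i)) \<in> borel_measurable M"
    by (intro borel_measurable_prod_ennreal measurable_compose[OF measurable_prob_algebraD[OF K]]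
        measurable_emeasure_subprob_algebra X)
  ultimately show "(\<lambda>x. emeasure (\<Pi>\<^sub>M i\<in>I. K i x) A) \<in> borel_measurable M"
    by (simp cong: measurable_cong)
qed

text \<open>Independence and zero means kill the cross terms of the squared sum. The family
  \<open>M\<close> consists of probability spaces at every index because the locale
  \<open>product_prob_space\<close> asks for a total family.\<close>

lemma variance_sum_PiM:
  fixes f :: "'i \<Rightarrow> 'a \<Rightarrow> real"
  assumes I: "finite I" and M: "\<And>i. prob_space (M i)"
    and f: "\<And>i. i \<in> I \<Longrightarrow> integrable (M i) (f i)" "\<And>i. i \<in> I \<Longrightarrow> (\<integral>x. f i x \<partial>M i) = 0"
    and f2: "\<And>i. i \<in> I \<Longrightarrow> integrable (M i) (\<lambda>x. (f i x)\<^sup>2)"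
  shows "integrable (Pi\<^sub>M I M) (\<lambda>x. (\<Sum>i\<in>I. f i (x i))\<^sup>2)"
    and "(\<integral>x. (\<Sum>i\<in>I. f i (x i))\<^sup>2 \<partial>Pi\<^sub>M I M) = (\<Sum>i\<in>I. \<integral>x. (f i x)\<^sup>2 \<partial>M i)"
proof -
  interpret M: prob_space "M i" for i by (rule M)
  interpret product_prob_space M ..
  \<comment> \<open>Writes \<open>f i (x i) * f j (x j)\<close> as a product over all of \<open>I\<close>.\<close>
  define F where "F i j k x =
      (if k = i \<and> k = j then (f k x)\<^sup>2 else if k = i \<or> k = j then f k x else 1)" for i j k x
  have F: "integrable (M k) (F i j k)" if "k \<in> I" for i j k
    unfolding F_def using f(1)[OF that] f2[OF that] by (cases "k = i"; cases "k = j") simp_all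
  have eq: "f i (x i) * f j (x j) = (\<Prod>k\<in>I. F i j k (x k))" if "i \<in> I" "j \<in> I" for i j x
  proof -
    have "(\<Prod>k\<in>I. F i j k (x k)) = (\<Prod>k\<in>{i, j}. F i j k (x k))"
      using that I by (intro prod.mono_neutral_right) (auto simp: F_def)
    also have "\<dots> = f i (x i) * f j (x j)"
      by (cases "i = j") (auto simp: F_def power2_eq_square)
    finally show ?thesis by simp
  qed
  have int: "integrable (Pi\<^sub>M I M) (\<lambda>x. f i (x i) * f j (x j))" if "i \<in> I" "j \<in> I" for i j
    unfolding eq[OF that] by (rule product_integrable_prod[OF I F])
  have val: "(\<integral>x. f i (x i) * f j (x j) \<partial>Pi\<^sub>M I M) = (if i = j then \<integral>x. (f i x)\<^sup>2 \<partial>M i else 0)"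
    if ij: "i \<in> I" "j \<in> I" for i j
  proof -
    have "(\<integral>x. f i (x i) * f j (x j) \<partial>Pi\<^sub>M I M) = (\<Prod>k\<in>I. \<integral>x. F i j k x \<partial>M k)"
      unfolding eq[OF ij] by (rule product_integral_prod[OF I F])
    \<comment> \<open>All other factors are the constant 1 and integrate to 1. For
      \<open>i \<noteq> j\<close> a product of two zero means remains.\<close>
    also have "\<dots> = (\<Prod>k\<in>{i, j}. \<integral>x. F i j k x \<partial>M k)"
      using ij I by (intro prod.mono_neutral_right) (auto simp: F_def M.prob_space)
    also have "\<dots> = (if i = j then \<integral>x. (f i x)\<^sup>2 \<partial>M i else 0)"
      using ij f(2) by (auto simp: F_def)
    finally show ?thesis .
  qed
  have sq: "(\<Sum>i\<in>I. f i (x i))\<^sup>2 = (\<Sum>i\<in>I. \<Sum>j\<in>I. f i (x i) * f j (x j))" for x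
    by (simp add: power2_eq_square sum_product)
  show "integrable (Pi\<^sub>M I M) (\<lambda>x. (\<Sum>i\<in>I. f i (x i))\<^sup>2)"
    unfolding sq by (intro Bochner_Integration.integrable_sum int)
  have "(\<integral>x. (\<Sum>i\<in>I. f i (x i))\<^sup>2 \<partial>Pi\<^sub>M I M) =
      (\<Sum>i\<in>I. \<Sum>j\<in>I. \<integral>x. f i (x i) * f j (x j) \<partial>Pi\<^sub>M I M)"
    unfolding sq by (simp add: Bochner_Integration.integral_sum Bochner_Integration.integrable_sum int)
  also have "\<dots> = (\<Sum>i\<in>I. \<Sum>j\<in>I. if i = j then \<integral>x. (f i x)\<^sup>2 \<partial>M i else 0)"
    by (intro sum.cong refl val)
  also have "\<dots> = (\<Sum>i\<in>I. \<integral>x. (f i x)\<^sup>2 \<partial>M i)"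
    using I by simp
  finally show "(\<integral>x. (\<Sum>i\<in>I. f i (x i))\<^sup>2 \<partial>Pi\<^sub>M I M) = (\<Sum>i\<in>I. \<integral>x. (f i x)\<^sup>2 \<partial>M i)" .
qed

lemma integral_PiM_component:
  fixes f :: "'a \<Rightarrow> real"
  assumes M: "\<And>i. i \<in> I \<Longrightarrow> prob_space (M i)" and i: "i \<in> I" and f: "integrable (M i) f"
  shows "integrable (Pi\<^sub>M I M) (\<lambda>x. f (x i))" and "(\<integral>x. f (x i) \<partial>Pi\<^sub>M I M) = (\<integral>x. f x \<partial>M i)"
proof -
  have D: "distr (Pi\<^sub>M I M) (M i) (\<lambda>x. x i) = M i"
    by (rule distr_PiM_component[OF M i])
  have meas: "(\<lambda>x. x i) \<in> Pi\<^sub>M I M \<rightarrow>\<^sub>M M i"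
    using i by (rule measurable_component_singleton)
  show "integrable (Pi\<^sub>M I M) (\<lambda>x. f (x i))"
    using f by (subst (asm) D[symmetric]) (rule integrable_distr[OF meas])
  show "(\<integral>x. f (x i) \<partial>Pi\<^sub>M I M) = (\<integral>x. f x \<partial>M i)"
    using integral_distr[OF meas, of f] f by (simp add: D borel_measurable_integrable)
qed

text \<open>A coordinate is dominated by the norm. The real-valued variance formula for independent
  sums is applied coordinate by coordinate and needs these second moments.\<close>

lemma gradient_oracle_coord_variance:
  assumes Q: "gradient_oracle d F \<sigma> Q" and y: "y \<in> euclid d" and j: "j < d"
  shows "integrable (Q y) (\<lambda>g. (lookup g j - lookup (gradient d F y) j)\<^sup>2)"
proof -
  have "norm (lookup x j) \<le> norm x" for x :: vect
    unfolding lookup_eq_inner_single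
    using Cauchy_Schwarz_ineq2[of x "Poly_Mapping.single j 1"]
    by (simp add: norm_eq_sqrt_inner[of "Poly_Mapping.single j (1::real)"] inner_poly_mapping_def)
  then have le: "norm ((lookup g j - lookup (gradient d F y) j)\<^sup>2) \<le> norm ((norm (g - gradient d F y))\<^sup>2)"
    for g :: vect
    by (metis abs_norm_cancel lookup_minus norm_power power_mono norm_ge_zero real_norm_def)
  have "(\<lambda>g. (lookup g j - lookup (gradient d F y) j)\<^sup>2) \<in> borel_measurable (Q y)"
    unfolding measurable_cong_sets[OF gradient_oracle_prob_space(2)[OF Q y] refl] by measurable
  from Bochner_Integration.integrable_bound[OF gradient_oracle_variance(1)[OF Q y] this]
  show ?thesis using le by simp
qed

lemma sum_coord_variance:
  assumes F: "smooth d H F" and Q: "gradient_oracle d F \<sigma> Q" and y: "y \<in> euclid d"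
  shows "(\<Sum>j<d. \<integral>g. (lookup g j - lookup (gradient d F y) j)\<^sup>2 \<partial>Q y) \<le> \<sigma>\<^sup>2"
proof -
  have space: "space (Q y) = euclid d"
    using sets_eq_imp_space_eq[OF gradient_oracle_prob_space(2)[OF Q y]] by simp
  have "(\<Sum>j<d. \<integral>g. (lookup g j - lookup (gradient d F y) j)\<^sup>2 \<partial>Q y) =
      (\<integral>g. (\<Sum>j<d. (lookup g j - lookup (gradient d F y) j)\<^sup>2) \<partial>Q y)"
    by (subst Bochner_Integration.integral_sum) (auto intro: gradient_oracle_coord_variance[OF Q y])
  also have "\<dots> = (\<integral>g. (norm (g - gradient d F y))\<^sup>2 \<partial>Q y)"
    by (intro Bochner_Integration.integral_cong refl)
      (simp add: space norm_euclid[OF subspace_diff[OF euclid_subspace _ gradient_in_euclid[OF F y]]]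
        lookup_minus sum_nonneg)
  also have "\<dots> \<le> \<sigma>\<^sup>2"
    by (rule gradient_oracle_variance[OF Q y])
  finally show ?thesis .
qed

text \<open>Linearity preserves the mean. The variances of the \<open>n\<close> independent answers
  add up and averaging divides by \<open>n\<^sup>2\<close>, which leaves
  \<open>\<sigma>\<^sup>2 / n\<close>. Hence one convergence result for general oracles serves both
  algorithms.\<close>

lemma round_average_gradient_oracle:
  assumes F: "smooth d H F" and Q: "oracles_for d F \<sigma> Q" and MK: "M \<ge> 1" "K \<ge> 1"
  shows "gradient_oracle d F (\<sigma> / sqrt (real (M * K))) (round_average d M K Q r)"
proof -
  define I where "I = {..<M} \<times> {..<K}"
  define n where "n = real (M * K)"
  define P where "P y = (\<Pi>\<^sub>M q\<in>I. case q of (m, k) \<Rightarrow> Q r m k y)" for y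
  define avg where "avg g = (1 / n) *\<^sub>R (\<Sum>q\<in>I. g q)" for g :: "nat \<times> nat \<Rightarrow> vect"
  have I: "finite I" "real (card I) = n" and n: "n > 0"
    using MK by (auto simp: I_def n_def)
  have single: "gradient_oracle d F \<sigma> (\<lambda>y. case q of (m, k) \<Rightarrow> Q r m k y)" for q
    using Q by (cases q) (auto simp: oracles_for_def)
  have ra: "round_average d M K Q r = (\<lambda>y. distr (P y) (borel_euclid d) avg)"
    by (simp add: round_average_def P_def avg_def[abs_def] I_def n_def fun_eq_iff)
  have avg: "avg \<in> (\<Pi>\<^sub>M q\<in>I. borel_euclid d) \<rightarrow>\<^sub>M borel_euclid d"
    unfolding avg_def
    by (intro measurable_scaleR_euclid measurable_sum_euclid measurable_component_singleton)
  have P: "P \<in> borel_euclid d \<rightarrow>\<^sub>M prob_algebra (\<Pi>\<^sub>M q\<in>I. borel_euclid d)"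
    unfolding P_def by (intro measurable_PiM_prob_algebra I gradient_oracle_kernel[OF single])
  have kernel: "round_average d M K Q r \<in> borel_euclid d \<rightarrow>\<^sub>M prob_algebra (borel_euclid d)"
    unfolding ra by (rule measurable_compose[OF P measurable_distr_prob_space[OF avg]])
  have lookup_avg: "lookup (avg g) j = (\<Sum>q\<in>I. lookup (g q) j) / n" for g j
    by (simp add: avg_def lookup_sum)
  have "(\<forall>j<d. integrable (distr (P y) (borel_euclid d) avg) (\<lambda>g. lookup g j) \<and>
          (\<integral>g. lookup g j \<partial>distr (P y) (borel_euclid d) avg) = lookup (gradient d F y) j) \<and>
       (\<integral>\<^sup>+g. ennreal ((norm (g - gradient d F y))\<^sup>2) \<partial>distr (P y) (borel_euclid d) avg)
          \<le> ennreal ((\<sigma> / sqrt n)\<^sup>2)" if y: "y \<in> euclid d" for y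
  proof -
    define R where "R = (\<lambda>(m, k). Q r m k y)"
    have R: "R q = (case q of (m, k) \<Rightarrow> Q r m k y)" for q
      by (simp add: R_def)
    have P_eq: "P y = Pi\<^sub>M I R"
      by (simp add: P_def R_def)
    have prob: "prob_space (R q)" for q
      unfolding R by (rule gradient_oracle_prob_space[OF single y])
    define D where "D j g = lookup g j - lookup (gradient d F y) j" for j and g :: vect
    have coord: "integrable (R q) (\<lambda>g. lookup g j)"
      "(\<integral>g. lookup g j \<partial>R q) = lookup (gradient d F y) j" if "j < d" for q j
      using single[of q] y that by (auto simp: gradient_oracle_def R)
    interpret R: prob_space "R q" for q by (rule prob)
    have D: "integrable (R q) (D j)" "(\<integral>g. D j g \<partial>R q) = 0" "integrable (R q) (\<lambda>g. (D j g)\<^sup>2)"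
      if "j < d" for q j
      using coord[OF that, of q] gradient_oracle_coord_variance[OF single y that, of q]
      unfolding D_def R[symmetric] by (simp_all add: R.prob_space)
    have measP: "avg \<in> P y \<rightarrow>\<^sub>M borel_euclid d"
      using avg measurable_space[OF P, of y] y measurable_cong_sets
      by (fastforce simp: space_prob_algebra)
    have mean: "integrable (distr (P y) (borel_euclid d) avg) (\<lambda>g. lookup g j) \<and>
          (\<integral>g. lookup g j \<partial>distr (P y) (borel_euclid d) avg) = lookup (gradient d F y) j"
      if j: "j < d" for j
    proof
      note comp = integral_PiM_component[where I = I and M = R, OF prob _ coord(1)[OF j]]
      show "integrable (distr (P y) (borel_euclid d) avg) (\<lambda>g. lookup g j)"
        unfolding integrable_distr_eq[OF measP measurable_lookup]
        unfolding lookup_avg P_eq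
        by (intro integrable_divide Bochner_Integration.integrable_sum comp)
      have "(\<integral>g. lookup g j \<partial>distr (P y) (borel_euclid d) avg) =
          (\<integral>g. (\<Sum>q\<in>I. lookup (g q) j) / n \<partial>Pi\<^sub>M I R)"
        unfolding integral_distr[OF measP measurable_lookup]
        unfolding lookup_avg P_eq ..
      also have "\<dots> = (\<Sum>q\<in>I. lookup (gradient d F y) j) / n"
        using comp coord(2)[OF j] by (simp add: Bochner_Integration.integral_sum)
      also have "\<dots> = lookup (gradient d F y) j"
        using I n by simp
      finally show "(\<integral>g. lookup g j \<partial>distr (P y) (borel_euclid d) avg) = lookup (gradient d F y) j" .
    qed
    \<comment> \<open>The squared deviation of the average in coordinates. It is identified with the
      squared norm on the space of \<open>P y\<close>, where the average lies in
      \<open>euclid d\<close>.\<close>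
    define V where "V g = (\<Sum>j<d. (\<Sum>q\<in>I. D j (g q))\<^sup>2) / n\<^sup>2" for g :: "nat \<times> nat \<Rightarrow> vect"
    have var: "integrable (Pi\<^sub>M I R) (\<lambda>g. (\<Sum>q\<in>I. D j (g q))\<^sup>2)"
      "(\<integral>g. (\<Sum>q\<in>I. D j (g q))\<^sup>2 \<partial>Pi\<^sub>M I R) = (\<Sum>q\<in>I. \<integral>g. (D j g)\<^sup>2 \<partial>R q)"
      if "j < d" for j
      using variance_sum_PiM[where f = "\<lambda>_. D j", OF I(1) prob] D[OF that] by auto
    have intV: "integrable (Pi\<^sub>M I R) V"
      unfolding V_def by (intro integrable_divide Bochner_Integration.integrable_sum var) auto
    have norm_avg: "(norm (avg g - gradient d F y))\<^sup>2 = V g" if "g \<in> space (P y)" for g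
    proof -
      have "avg g - gradient d F y \<in> euclid d"
        using measurable_space[OF measP that] gradient_in_euclid[OF F y]
        by (auto intro: subspace_diff euclid_subspace)
      then have "(norm (avg g - gradient d F y))\<^sup>2 = (\<Sum>j<d. (lookup (avg g) j - lookup (gradient d F y) j)\<^sup>2)"
        by (simp add: norm_euclid lookup_minus sum_nonneg)
      \<comment> \<open>As \<open>I\<close> has \<open>n\<close> elements, the gradient coordinate
        is the average of \<open>n\<close> copies of itself and moves into the sum.\<close>
      also have "\<dots> = (\<Sum>j<d. ((\<Sum>q\<in>I. D j (g q)) / n)\<^sup>2)"
        using I n by (simp add: lookup_avg D_def sum_subtractf field_simps)
      also have "\<dots> = V g"
        by (simp only: V_def power_divide sum_divide_distrib[symmetric])
      finally show ?thesis .
    qed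
    have meas_dist: "(\<lambda>g. ennreal ((norm (g - gradient d F y))\<^sup>2)) \<in> borel_measurable (borel_euclid d)"
      by (intro measurable_compose[OF _ measurable_ennreal]
          continuous_on_imp_measurable_borel_euclid continuous_intros)
    have "(\<integral>\<^sup>+g. ennreal ((norm (g - gradient d F y))\<^sup>2) \<partial>distr (P y) (borel_euclid d) avg) =
        (\<integral>\<^sup>+g. ennreal ((norm (avg g - gradient d F y))\<^sup>2) \<partial>P y)"
      by (rule nn_integral_distr[OF measP]) (simp add: meas_dist)
    also have "\<dots> = (\<integral>\<^sup>+g. ennreal (V g) \<partial>P y)"
      by (intro nn_integral_cong) (simp add: norm_avg)
    also have "\<dots> = ennreal (\<integral>g. V g \<partial>Pi\<^sub>M I R)"
      unfolding P_eq by (rule nn_integral_eq_integral[OF intV]) (simp add: V_def sum_nonneg)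
    also have "(\<integral>g. V g \<partial>Pi\<^sub>M I R) = (\<Sum>j<d. \<Sum>q\<in>I. \<integral>g. (D j g)\<^sup>2 \<partial>R q) / n\<^sup>2"
      unfolding V_def by (simp add: Bochner_Integration.integral_sum var)
    \<comment> \<open>Regrouped by query, the inner sum is the total variance of one answer.\<close>
    also have "\<dots> = (\<Sum>q\<in>I. \<Sum>j<d. \<integral>g. (D j g)\<^sup>2 \<partial>R q) / n\<^sup>2"
      by (subst sum.swap) simp
    also have "\<dots> \<le> (\<Sum>q\<in>I. \<sigma>\<^sup>2) / n\<^sup>2"
      unfolding D_def R by (intro divide_right_mono sum_mono sum_coord_variance[OF F single y]) simp
    also have "\<dots> = (\<sigma> / sqrt n)\<^sup>2"
      using I n by (simp add: power_divide power2_eq_square)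
    finally show ?thesis
      using mean by (simp add: ennreal_leI)
  qed
  then show ?thesis
    unfolding gradient_oracle_def n_def[symmetric] using kernel by (simp add: ra)
qed

section \<open>Convergence of AC-SA\<close>

text \<open>The descent lemma at \<open>xmd\<close> is combined with the tangent inequalities
  towards \<open>xag\<close> and \<open>u\<close> and with the expansion of the squared distance to
  \<open>u\<close> under the step from \<open>x\<close> to \<open>x'\<close>.\<close>

lemma acsa_one_step:
  fixes x xag g u :: vect and a \<gamma> :: real
  assumes F: "smooth d H F" "convex_on (euclid d) F"
    and in_euclid: "x \<in> euclid d" "xag \<in> euclid d" "g \<in> euclid d" "u \<in> euclid d"
    and a: "0 \<le> a" "a \<le> 1" and \<gamma>: "\<gamma> > 0" and step: "2 * H * (a * \<gamma>) \<le> 1"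
    and xmd: "xmd = a *\<^sub>R x + (1 - a) *\<^sub>R xag" and x': "x' = x - \<gamma> *\<^sub>R g"
    and xag': "xag' = a *\<^sub>R x' + (1 - a) *\<^sub>R xag"
    and \<xi>: "\<xi> = g - gradient d F xmd"
  shows "F xag' - F u \<le> (1 - a) * (F xag - F u) + a / (2 * \<gamma>) * ((norm (x - u))\<^sup>2 - (norm (x' - u))\<^sup>2)
           - a * (\<xi> \<bullet> (x - u)) + a * \<gamma> * (norm \<xi>)\<^sup>2"
proof -
  define n where "n = gradient d F xmd"
  have E: "xmd \<in> euclid d" "x' \<in> euclid d" "xag' \<in> euclid d"
    unfolding xmd x' xag'
    by (intro subspace_add subspace_diff subspace_scale euclid_subspace in_euclid)+
  have diff: "xag' - xmd = (- a * \<gamma>) *\<^sub>R g"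
    by (simp add: xag' xmd x' algebra_simps)
  \<comment> \<open>Inserting \<open>u\<close> makes the first two summands match the tangent
    inequalities towards \<open>xag\<close> and \<open>u\<close>, with nonnegative weights
    \<open>1 - a\<close> and \<open>a\<close> of sum 1.\<close>
  have split: "xag' - xmd = (1 - a) *\<^sub>R (xag - xmd) + a *\<^sub>R (u - xmd) + a *\<^sub>R (x' - u)"
    by (simp add: xag' algebra_simps)
  have "F xag' \<le> F xmd + n \<bullet> (xag' - xmd) + H / 2 * (norm (xag' - xmd))\<^sup>2"
    unfolding n_def by (rule smooth_upper_bound[OF F(1)]) (use E in auto)
  also have "\<dots> = (1 - a) * (F xmd + n \<bullet> (xag - xmd)) + a * (F xmd + n \<bullet> (u - xmd))
      + a * (n \<bullet> (x' - u)) + H / 2 * (a * \<gamma>)\<^sup>2 * (g \<bullet> g)"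
    \<comment> \<open>The displacement stays a multiple of \<open>g\<close> in the quadratic term
      and is split in the linear term.\<close>
    unfolding diff power2_norm_eq_inner
    by (subst diff[symmetric], subst split) (simp add: algebra_simps power2_eq_square)
  also have "\<dots> \<le> (1 - a) * F xag + a * F u + a * (n \<bullet> (x' - u)) + H / 2 * (a * \<gamma>)\<^sup>2 * (g \<bullet> g)"
    unfolding n_def
    by (intro add_mono mult_left_mono convex_lower_bound[OF F] order_refl) (use E in_euclid a in auto)
  finally have 1: "F xag' - F u \<le> (1 - a) * (F xag - F u) + a * (n \<bullet> (x' - u))
      + H / 2 * (a * \<gamma>)\<^sup>2 * (g \<bullet> g)"
    by (simp add: algebra_simps)
  have "H / 2 * (a * \<gamma>)\<^sup>2 * (g \<bullet> g) = (2 * H * (a * \<gamma>)) * (a * \<gamma> / 4 * (g \<bullet> g))"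
    by (simp add: power2_eq_square)
  also have "\<dots> \<le> 1 * (a * \<gamma> / 4 * (g \<bullet> g))"
    using a \<gamma> step by (intro mult_right_mono) auto
  finally have 2: "H / 2 * (a * \<gamma>)\<^sup>2 * (g \<bullet> g) \<le> a * \<gamma> / 4 * (g \<bullet> g)" by simp
  have x'u: "x' - u = (x - u) - \<gamma> *\<^sub>R g" by (simp add: x')
  have 3: "(norm (x - u))\<^sup>2 - (norm (x' - u))\<^sup>2 = 2 * \<gamma> * (g \<bullet> (x - u)) - \<gamma>\<^sup>2 * (g \<bullet> g)"
    and 4: "n \<bullet> (x' - u) = n \<bullet> (x - u) - \<gamma> * (n \<bullet> g)"
    unfolding power2_norm_eq_inner x'u
    by (simp_all add: inner_diff_left inner_diff_right inner_commute power2_eq_square algebra_simps)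
  have 5: "(norm \<xi>)\<^sup>2 = g \<bullet> g - 2 * (n \<bullet> g) + n \<bullet> n" "\<xi> \<bullet> (x - u) = g \<bullet> (x - u) - n \<bullet> (x - u)"
    unfolding power2_norm_eq_inner \<xi> n_def
    by (simp_all add: inner_diff_left inner_diff_right inner_commute)
  \<comment> \<open>Young's inequality for the product of the noise \<open>\<xi> = g - n\<close> with the step \<open>- \<gamma> *\<^sub>R g\<close>.\<close>
  have "0 \<le> a * \<gamma> * ((norm (n - (1 / 2) *\<^sub>R g))\<^sup>2)"
    using a \<gamma> by simp
  also have "\<dots> = a * \<gamma> * (n \<bullet> n - n \<bullet> g + (g \<bullet> g) / 4)"
    unfolding power2_norm_eq_inner
    by (simp add: inner_diff_left inner_diff_right inner_commute algebra_simps)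
  finally have 6: "0 \<le> a * \<gamma> * (n \<bullet> n - n \<bullet> g + (g \<bullet> g) / 4)" .
  \<comment> \<open>Once the curvature term is replaced by
    \<open>a * \<gamma> / 4 * (g \<bullet> g)\<close>, the two sides of the claim differ exactly by
    the square in Young's inequality.\<close>
  have "a / (2 * \<gamma>) * (2 * \<gamma> * (g \<bullet> (x - u)) - \<gamma>\<^sup>2 * (g \<bullet> g)) =
      a * (g \<bullet> (x - u)) - a * \<gamma> / 2 * (g \<bullet> g)"
    using \<gamma> by (simp add: field_simps power2_eq_square)
  with 1 2 6 show ?thesis
    unfolding 3 4 5 by (simp add: algebra_simps)
qed

section \<open>The law of the AC-SA state as a Markov chain\<close>

abbreviation states :: "nat \<Rightarrow> (vect \<times> vect) measure" where
  "states d \<equiv> borel_euclid d \<Otimes>\<^sub>M borel_euclid d"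

lemma space_states: "space (states d) = euclid d \<times> euclid d"
  by (simp add: space_pair_measure)

lemma acsa_query_measurable [measurable]: "acsa_query \<beta> t \<in> states d \<rightarrow>\<^sub>M borel_euclid d"
  unfolding acsa_query_def by measurable

lemma acsa_query_in_euclid: "x \<in> euclid d \<Longrightarrow> xag \<in> euclid d \<Longrightarrow> acsa_query \<beta> t (x, xag) \<in> euclid d"
  by (auto simp: acsa_query_def intro!: subspace_add subspace_scale euclid_subspace)

lemma acsa_update_measurable [measurable]:
  "case_prod (acsa_update \<beta> \<gamma> t) \<in> states d \<Otimes>\<^sub>M borel_euclid d \<rightarrow>\<^sub>M states d"
  unfolding acsa_update_def Let_def split_beta by measurable

lemma acsa_step_kernel:
  assumes "G t \<in> borel_euclid d \<rightarrow>\<^sub>M prob_algebra (borel_euclid d)"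
  shows "(\<lambda>s. distr (G t (acsa_query \<beta> t s)) (states d) (acsa_update \<beta> \<gamma> t s))
           \<in> states d \<rightarrow>\<^sub>M prob_algebra (states d)"
  by (rule measurable_distr_prob_space2[OF measurable_compose[OF acsa_query_measurable assms]])
    (simp add: acsa_update_measurable)

lemma acsa_state_in_prob_algebra:
  assumes "\<And>t. G t \<in> borel_euclid d \<rightarrow>\<^sub>M prob_algebra (borel_euclid d)"
  shows "acsa_state d \<beta> \<gamma> G t \<in> space (prob_algebra (states d))"
proof (induction t)
  case 0
  then show ?case
    by (auto simp: space_prob_algebra space_states intro!: prob_space_return)
next
  case (Suc t)
  then show ?case
    using prob_space_bind'[OF Suc acsa_step_kernel[of G t, OF assms]]
      sets_bind'[OF Suc acsa_step_kernel[of G t, OF assms]]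
    by (simp add: space_prob_algebra)
qed

text \<open>These parameters make the update send (0, 0) to itself whatever the answer, and the
  image of a probability measure under a constant map is a Dirac measure.\<close>

lemma acsa_state_constant:
  assumes G: "\<And>t. G t \<in> borel_euclid d \<rightarrow>\<^sub>M prob_algebra (borel_euclid d)"
  shows "acsa_state d (\<lambda>_. 1) (\<lambda>_. 0) G t = return (states d) (0, 0)"
proof (induction t)
  case (Suc t)
  let ?K = "\<lambda>s. distr (G t (acsa_query (\<lambda>_. 1) t s)) (states d) (acsa_update (\<lambda>_. 1) (\<lambda>_. 0) t s)"
  have "acsa_query (\<lambda>_. 1) t (0, 0) \<in> euclid d"
    by (simp add: acsa_query_def)
  then have "prob_space (G t (acsa_query (\<lambda>_. 1) t (0, 0)))"
    using measurable_space[OF G, of _ t] by (auto simp: space_prob_algebra)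
  then have "?K (0, 0) = return (states d) (0, 0)"
    using prob_space.distr_const[of _ "(0, 0)" "states d"]
    by (simp add: acsa_update_def space_states)
  moreover have "return (states d) (0, 0) \<bind> ?K = ?K (0, 0)"
    using acsa_step_kernel[of G t, OF G]
    by (intro bind_return[where N = "states d"] measurable_prob_algebraD) (simp_all add: space_states)
  ultimately show ?case
    by (simp only: acsa_state.simps Suc)
qed simp

text \<open>Tower property: given the state, integrate over one fresh answer. Nonnegative integrals
  spare integrability proofs along the induction.\<close>

lemma nn_integral_acsa_state_Suc:
  assumes G: "\<And>t. G t \<in> borel_euclid d \<rightarrow>\<^sub>M prob_algebra (borel_euclid d)"
    and f: "f \<in> borel_measurable (states d)"
  shows "(\<integral>\<^sup>+s. f s \<partial>acsa_state d \<beta> \<gamma> G (Suc t)) =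
    (\<integral>\<^sup>+s. \<integral>\<^sup>+g. f (acsa_update \<beta> \<gamma> t s g) \<partial>G t (acsa_query \<beta> t s) \<partial>acsa_state d \<beta> \<gamma> G t)"
proof -
  let ?K = "\<lambda>s. distr (G t (acsa_query \<beta> t s)) (states d) (acsa_update \<beta> \<gamma> t s)"
  have sets: "sets (acsa_state d \<beta> \<gamma> G t) = sets (states d)"
    using acsa_state_in_prob_algebra[OF G] by (simp add: space_prob_algebra)
  have "?K \<in> acsa_state d \<beta> \<gamma> G t \<rightarrow>\<^sub>M subprob_algebra (states d)"
    unfolding measurable_cong_sets[OF sets refl]
    by (intro measurable_prob_algebraD acsa_step_kernel G)
  then have "(\<integral>\<^sup>+s. f s \<partial>acsa_state d \<beta> \<gamma> G (Suc t)) =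
      (\<integral>\<^sup>+s. \<integral>\<^sup>+z. f z \<partial>?K s \<partial>acsa_state d \<beta> \<gamma> G t)"
    unfolding acsa_state.simps by (rule nn_integral_bind[OF f])
  also have "\<dots> = (\<integral>\<^sup>+s. \<integral>\<^sup>+g. f (acsa_update \<beta> \<gamma> t s g) \<partial>G t (acsa_query \<beta> t s) \<partial>acsa_state d \<beta> \<gamma> G t)"
  proof (intro nn_integral_cong nn_integral_distr)
    fix s assume "s \<in> space (acsa_state d \<beta> \<gamma> G t)"
    then have s: "s \<in> space (states d)"
      using sets_eq_imp_space_eq[OF sets] by simp
    have sets_G: "sets (G t (acsa_query \<beta> t s)) = sets (borel_euclid d)"
      using measurable_space[OF measurable_compose[OF acsa_query_measurable G] s]
      by (simp add: space_prob_algebra)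
    show "acsa_update \<beta> \<gamma> t s \<in> G t (acsa_query \<beta> t s) \<rightarrow>\<^sub>M states d"
      unfolding measurable_cong_sets[OF sets_G refl]
      using measurable_Pair2[OF acsa_update_measurable s] by simp
  qed (simp add: f)
  finally show ?thesis .
qed

section \<open>The potential and its expected growth\<close>

text \<open>The distance weight \<open>2 / \<eta>\<close> is the same for all \<open>t\<close>: the
  growth of the step sizes compensates that of the gap weight, so the distance terms
  telescope.\<close>

definition acsa_potential :: "(vect \<Rightarrow> real) \<Rightarrow> vect \<Rightarrow> real \<Rightarrow> nat \<Rightarrow> vect \<times> vect \<Rightarrow> real" where
  "acsa_potential F u \<eta> t = (\<lambda>(x, xag). (real t + 1)\<^sup>2 * (F xag - F u) + 2 / \<eta> * (norm (x - u))\<^sup>2)"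

text \<open>The one-step inequality with \<open>a = 2 / w\<close>, multiplied by
  \<open>w\<^sup>2\<close> for \<open>w = t + 2\<close>, which is the gap weight of the potential at
  \<open>Suc t\<close>.\<close>

lemma acsa_potential_step:
  fixes x xag g u :: vect and \<eta> :: real and t :: nat
  defines "\<beta> \<equiv> \<lambda>t::nat. (real t + 2) / 2" and "\<gamma> \<equiv> \<lambda>t::nat. \<eta> * (real t + 2) / 2"
  defines "y \<equiv> acsa_query \<beta> t (x, xag)"
  assumes F: "smooth d H F" "convex_on (euclid d) F"
    and min: "\<And>x. x \<in> euclid d \<Longrightarrow> F u \<le> F x"
    and in_euclid: "x \<in> euclid d" "xag \<in> euclid d" "g \<in> euclid d" "u \<in> euclid d"
    and \<eta>: "\<eta> > 0" "2 * H * \<eta> \<le> 1"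
  shows "acsa_potential F u \<eta> (Suc t) (acsa_update \<beta> \<gamma> t (x, xag) g) \<le>
     acsa_potential F u \<eta> t (x, xag) - 2 * (real t + 2) * ((g - gradient d F y) \<bullet> (x - u))
       + \<eta> * (real t + 2)\<^sup>2 * (norm (g - gradient d F y))\<^sup>2"
proof -
  define w where "w = real t + 2"
  define a where "a = 2 / w"
  define x' where "x' = x - \<gamma> t *\<^sub>R g"
  define xag' where "xag' = a *\<^sub>R x' + (1 - a) *\<^sub>R xag"
  define \<xi> where "\<xi> = g - gradient d F y"
  have w: "w \<ge> 2" by (simp add: w_def)
  have inv: "inverse (\<beta> t) = a"
    by (simp add: \<beta>_def a_def w_def)
  \<comment> \<open>\<open>a * \<gamma> t\<close> is \<open>\<eta>\<close> in every iteration, so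
    \<open>2 * H * \<eta> \<le> 1\<close> is the step size condition for all of them.\<close>
  have \<gamma>: "\<gamma> t = \<eta> * w / 2" and a\<gamma>: "a * \<gamma> t = \<eta>"
    using w by (simp_all add: \<gamma>_def a_def w_def)
  have "F xag' - F u \<le> (1 - a) * (F xag - F u)
      + a / (2 * \<gamma> t) * ((norm (x - u))\<^sup>2 - (norm (x' - u))\<^sup>2) - a * (\<xi> \<bullet> (x - u)) + a * \<gamma> t * (norm \<xi>)\<^sup>2"
    by (rule acsa_one_step[OF F in_euclid _ _ _ _ _ x'_def xag'_def \<xi>_def])
      (use w \<eta> in \<open>auto simp: \<gamma> a_def y_def acsa_query_def inv\<close>)
  then have "w\<^sup>2 * (F xag' - F u) \<le> w\<^sup>2 * ((1 - a) * (F xag - F u)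
      + a / (2 * \<gamma> t) * ((norm (x - u))\<^sup>2 - (norm (x' - u))\<^sup>2) - a * (\<xi> \<bullet> (x - u)) + a * \<gamma> t * (norm \<xi>)\<^sup>2)"
    by (rule mult_left_mono) simp
  also have "\<dots> = w\<^sup>2 * (1 - a) * (F xag - F u)
      + w\<^sup>2 * (a / (2 * \<gamma> t)) * ((norm (x - u))\<^sup>2 - (norm (x' - u))\<^sup>2)
      - w\<^sup>2 * a * (\<xi> \<bullet> (x - u)) + w\<^sup>2 * \<eta> * (norm \<xi>)\<^sup>2"
    by (simp add: algebra_simps a\<gamma>)
  also have "w\<^sup>2 * (a / (2 * \<gamma> t)) = 2 / \<eta>"
    using w \<eta> by (simp add: a_def \<gamma> power2_eq_square)
  also have "w\<^sup>2 * a = 2 * w"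
    using w by (simp add: a_def power2_eq_square)
  also have "w\<^sup>2 * (1 - a) = real t * (real t + 2)"
    using w by (simp add: a_def power2_eq_square algebra_simps) (simp add: w_def algebra_simps)
  \<comment> \<open>The left weight is one less than \<open>(t + 1)\<^sup>2\<close>; it may be
    enlarged since the gap is nonnegative.\<close>
  also have "real t * (real t + 2) * (F xag - F u) \<le> (real t + 1)\<^sup>2 * (F xag - F u)"
    using min[OF in_euclid(2)] by (intro mult_right_mono) (auto simp: power2_eq_square algebra_simps)
  finally have "w\<^sup>2 * (F xag' - F u) + 2 / \<eta> * (norm (x' - u))\<^sup>2 \<le>
      (real t + 1)\<^sup>2 * (F xag - F u) + 2 / \<eta> * (norm (x - u))\<^sup>2
        - 2 * w * (\<xi> \<bullet> (x - u)) + \<eta> * w\<^sup>2 * (norm \<xi>)\<^sup>2"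
    by (simp add: algebra_simps)
  moreover have "acsa_update \<beta> \<gamma> t (x, xag) g = (x', xag')"
    by (simp add: acsa_update_def Let_def inv x'_def xag'_def)
  moreover have "1 + real (Suc t) = w" by (simp add: w_def)
  ultimately show ?thesis
    by (simp add: acsa_potential_def \<xi>_def w_def add.commute[of 2])
qed

text \<open>Given the state, \<open>x - u\<close> is fixed, so the linear noise term averages out
  and each iteration adds only its quadratic noise term.\<close>

lemma acsa_potential_expectation:
  fixes u :: vect and \<eta> :: real
  defines "\<beta> \<equiv> \<lambda>t::nat. (real t + 2) / 2" and "\<gamma> \<equiv> \<lambda>t::nat. \<eta> * (real t + 2) / 2"
  assumes F: "smooth d H F" "convex_on (euclid d) F"
    and u: "u \<in> euclid d" and min: "\<And>x. x \<in> euclid d \<Longrightarrow> F u \<le> F x"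
    and \<eta>: "\<eta> > 0" "2 * H * \<eta> \<le> 1"
    and G: "\<And>t. gradient_oracle d F \<sigma> (G t)"
  shows "(\<integral>\<^sup>+s. ennreal (acsa_potential F u \<eta> t s) \<partial>acsa_state d \<beta> \<gamma> G t)
    \<le> ennreal (F 0 - F u + 2 / \<eta> * (norm u)\<^sup>2 + \<eta> * \<sigma>\<^sup>2 * (\<Sum>j<t. (real j + 2)\<^sup>2))"
proof (induction t)
  have kernel: "G t \<in> borel_euclid d \<rightarrow>\<^sub>M prob_algebra (borel_euclid d)" for t
    by (rule gradient_oracle_kernel[OF G])
  have [measurable]: "F \<in> borel_measurable (borel_euclid d)"
    by (rule continuous_on_imp_measurable_borel_euclid[OF smooth_continuous_on[OF F(1)]])
  have [measurable]: "(\<lambda>x. norm (x - u)) \<in> borel_measurable (borel_euclid d)"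
    by (intro continuous_on_imp_measurable_borel_euclid continuous_intros)
  have meas: "(\<lambda>s. ennreal (acsa_potential F u \<eta> t s)) \<in> borel_measurable (states d)" for t
    unfolding acsa_potential_def by measurable
  \<comment> \<open>This rests on minimality of \<open>u\<close> over \<open>euclid d\<close>, and
    lets \<open>ennreal\<close> distribute over the sum in the induction step.\<close>
  have nonneg: "0 \<le> acsa_potential F u \<eta> t s" if "s \<in> euclid d \<times> euclid d" for s t
    using that min \<eta> by (auto simp: acsa_potential_def)
  case 0
  show ?case
    unfolding acsa_state.simps
    by (subst nn_integral_return[OF _ meas]) (simp_all add: space_states acsa_potential_def)
  case (Suc t)
  have mu: "prob_space (acsa_state d \<beta> \<gamma> G t)"
    and sets: "sets (acsa_state d \<beta> \<gamma> G t) = sets (states d)"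
    using acsa_state_in_prob_algebra[of G, OF kernel] by (simp_all add: space_prob_algebra)
  have space: "space (acsa_state d \<beta> \<gamma> G t) = euclid d \<times> euclid d"
    using sets_eq_imp_space_eq[OF sets] by (simp add: space_states)
  have bound: "(\<integral>\<^sup>+g. ennreal (acsa_potential F u \<eta> (Suc t) (acsa_update \<beta> \<gamma> t s g)) \<partial>G t (acsa_query \<beta> t s))
      \<le> ennreal (acsa_potential F u \<eta> t s) + ennreal (\<eta> * (real t + 2)\<^sup>2 * \<sigma>\<^sup>2)"
    if s: "s \<in> euclid d \<times> euclid d" for s
  proof -
    obtain x xag where s_eq: "s = (x, xag)" and E: "x \<in> euclid d" "xag \<in> euclid d"
      using s by auto
    have upd: "acsa_update \<beta> \<gamma> t (x, xag) g \<in> euclid d \<times> euclid d" if "g \<in> euclid d" for g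
      using E that
      by (auto simp: acsa_update_def Let_def
          intro!: subspace_add subspace_diff subspace_scale euclid_subspace)
    have "(\<integral>\<^sup>+g. ennreal (acsa_potential F u \<eta> (Suc t) (acsa_update \<beta> \<gamma> t (x, xag) g)) \<partial>G t (acsa_query \<beta> t (x, xag)))
      \<le> ennreal (acsa_potential F u \<eta> t (x, xag) + \<eta> * (real t + 2)\<^sup>2 * \<sigma>\<^sup>2)"
    proof (rule gradient_oracle_nn_integral_le[OF G])
      show "acsa_query \<beta> t (x, xag) \<in> euclid d" by (rule acsa_query_in_euclid[OF E])
      show "x - u \<in> euclid d" using E u by (intro subspace_diff euclid_subspace)
      show "0 \<le> \<eta> * (real t + 2)\<^sup>2" using \<eta> by simp
      show "0 \<le> acsa_potential F u \<eta> (Suc t) (acsa_update \<beta> \<gamma> t (x, xag) g)" if "g \<in> euclid d" for g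
        by (rule nonneg[OF upd[OF that]])
    \<comment> \<open>The pathwise bound is the majorant, with \<open>b = 2 (t + 2)\<close>,
      \<open>v = x - u\<close> and \<open>c = \<eta> (t + 2)\<^sup>2\<close>.\<close>
    qed (unfold \<beta>_def \<gamma>_def, rule acsa_potential_step[OF F min E _ u \<eta>], assumption+)
    then show ?thesis
      using nonneg[OF s, of t] \<eta> by (simp add: s_eq ennreal_plus)
  qed
  have "(\<integral>\<^sup>+s. ennreal (acsa_potential F u \<eta> (Suc t) s) \<partial>acsa_state d \<beta> \<gamma> G (Suc t)) \<le>
      (\<integral>\<^sup>+s. ennreal (acsa_potential F u \<eta> t s) + ennreal (\<eta> * (real t + 2)\<^sup>2 * \<sigma>\<^sup>2) \<partial>acsa_state d \<beta> \<gamma> G t)"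
    unfolding nn_integral_acsa_state_Suc[OF kernel meas]
    by (rule nn_integral_mono) (simp add: bound space)
  also have "\<dots> = (\<integral>\<^sup>+s. ennreal (acsa_potential F u \<eta> t s) \<partial>acsa_state d \<beta> \<gamma> G t)
      + ennreal (\<eta> * (real t + 2)\<^sup>2 * \<sigma>\<^sup>2)"
    using meas[of t] prob_space.emeasure_space_1[OF mu]
    by (subst nn_integral_add) (auto simp: measurable_cong_sets[OF sets refl])
  also have "\<dots> \<le> ennreal (F 0 - F u + 2 / \<eta> * (norm u)\<^sup>2 + \<eta> * \<sigma>\<^sup>2 * (\<Sum>j<t. (real j + 2)\<^sup>2))
      + ennreal (\<eta> * (real t + 2)\<^sup>2 * \<sigma>\<^sup>2)"
    by (intro add_right_mono Suc)
  also have "\<dots> = ennreal (F 0 - F u + 2 / \<eta> * (norm u)\<^sup>2 + \<eta> * \<sigma>\<^sup>2 * (\<Sum>j<Suc t. (real j + 2)\<^sup>2))"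
    using \<eta> min[OF zero_in_euclid]
    by (subst ennreal_plus[symmetric])
      (auto simp: algebra_simps intro!: sum_nonneg add_increasing2 mult_nonneg_nonneg)
  finally show ?case .
qed

text \<open>Drop the distance term of the potential and divide by \<open>(T + 1)\<^sup>2\<close>.
  Bounding the initial gap by \<open>1 / \<eta> * (norm u)\<^sup>2\<close> turns the factor 2 into
  3.\<close>

lemma acsa_gap:
  fixes u :: vect and \<eta> :: real
  defines "\<beta> \<equiv> \<lambda>t::nat. (real t + 2) / 2" and "\<gamma> \<equiv> \<lambda>t::nat. \<eta> * (real t + 2) / 2"
  assumes F: "smooth d H F" "convex_on (euclid d) F"
    and u: "u \<in> euclid d" and min: "\<And>x. x \<in> euclid d \<Longrightarrow> F u \<le> F x"
    and \<eta>: "\<eta> > 0" "2 * H * \<eta> \<le> 1"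
    and G: "\<And>t. gradient_oracle d F \<sigma> (G t)"
  shows "integrable (acsa d \<beta> \<gamma> G T) F"
    and "(\<integral>x. F x \<partial>acsa d \<beta> \<gamma> G T) - F u \<le>
      3 * (norm u)\<^sup>2 / (\<eta> * (real T + 1)\<^sup>2) + \<eta> * \<sigma>\<^sup>2 * real T"
proof -
  have kernel: "G t \<in> borel_euclid d \<rightarrow>\<^sub>M prob_algebra (borel_euclid d)" for t
    by (rule gradient_oracle_kernel[OF G])
  have mu: "prob_space (acsa_state d \<beta> \<gamma> G T)"
    and sets: "sets (acsa_state d \<beta> \<gamma> G T) = sets (states d)"
    using acsa_state_in_prob_algebra[of G, OF kernel] by (simp_all add: space_prob_algebra)
  have space: "space (acsa_state d \<beta> \<gamma> G T) = euclid d \<times> euclid d"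
    using sets_eq_imp_space_eq[OF sets] by (simp add: space_states)
  have snd: "snd \<in> acsa_state d \<beta> \<gamma> G T \<rightarrow>\<^sub>M borel_euclid d"
    unfolding measurable_cong_sets[OF sets refl] by measurable
  interpret A: prob_space "acsa d \<beta> \<gamma> G T"
    unfolding acsa_def by (rule prob_space.prob_space_distr[OF mu snd])
  have [measurable]: "F \<in> borel_measurable (borel_euclid d)"
    by (rule continuous_on_imp_measurable_borel_euclid[OF smooth_continuous_on[OF F(1)]])
  have measF: "F \<in> borel_measurable (acsa d \<beta> \<gamma> G T)"
    by (simp add: acsa_def)
  define w where "w = (real T + 1)\<^sup>2"
  have w: "w > 0" by (simp add: w_def)
  define C where "C = F 0 - F u + 2 / \<eta> * (norm u)\<^sup>2 + \<eta> * \<sigma>\<^sup>2 * (\<Sum>j<T. (real j + 2)\<^sup>2)"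
  have C0: "0 \<le> C"
    unfolding C_def using \<eta> min[OF zero_in_euclid]
    by (auto intro!: add_nonneg_nonneg mult_nonneg_nonneg sum_nonneg)
  have "(\<integral>\<^sup>+x. ennreal (w * (F x - F u)) \<partial>acsa d \<beta> \<gamma> G T) =
      (\<integral>\<^sup>+s. ennreal (w * (F (snd s) - F u)) \<partial>acsa_state d \<beta> \<gamma> G T)"
    unfolding acsa_def by (rule nn_integral_distr[OF snd]) measurable
  also have "\<dots> \<le> (\<integral>\<^sup>+s. ennreal (acsa_potential F u \<eta> T s) \<partial>acsa_state d \<beta> \<gamma> G T)"
    using \<eta> by (intro nn_integral_mono ennreal_leI) (auto simp: acsa_potential_def w_def)
  also have "\<dots> \<le> ennreal C"
    unfolding C_def \<beta>_def \<gamma>_def by (rule acsa_potential_expectation[OF F u min \<eta> G])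
  finally have le: "(\<integral>\<^sup>+x. ennreal (w * (F x - F u)) \<partial>acsa d \<beta> \<gamma> G T) \<le> ennreal C" .
  have nonneg: "AE x in acsa d \<beta> \<gamma> G T. 0 \<le> w * (F x - F u)"
    using min w by (intro AE_I2) (simp add: acsa_def)
  have int: "integrable (acsa d \<beta> \<gamma> G T) (\<lambda>x. w * (F x - F u))"
    using measF le nonneg
    by (intro integrableI_nonneg) (auto intro: le_less_trans)
  have "integrable (acsa d \<beta> \<gamma> G T) (\<lambda>x. w * (F x - F u) / w + F u)"
    by (intro Bochner_Integration.integrable_add integrable_divide int) auto
  then show intF: "integrable (acsa d \<beta> \<gamma> G T) F"
    using w by simp
  have "ennreal (\<integral>x. w * (F x - F u) \<partial>acsa d \<beta> \<gamma> G T) \<le> ennreal C"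
    using le nn_integral_eq_integral[OF int nonneg] by simp
  then have "w * ((\<integral>x. F x \<partial>acsa d \<beta> \<gamma> G T) - F u) \<le> C"
    using C0 intF by (simp add: ennreal_le_iff A.prob_space)
  also have "C \<le> 3 / \<eta> * (norm u)\<^sup>2 + \<eta> * \<sigma>\<^sup>2 * (real T * w)"
  proof -
    have "F 0 - F u \<le> H / 2 * (norm u)\<^sup>2"
      using smooth_minimum_gap[OF F(1) u min zero_in_euclid] by simp
    also have "\<dots> \<le> 1 / \<eta> * (norm u)\<^sup>2"
      using \<eta> by (intro mult_right_mono) (auto simp: field_simps)
    finally have "F 0 - F u \<le> 1 / \<eta> * (norm u)\<^sup>2" .
    \<comment> \<open>For \<open>j < T\<close>, \<open>j + 2\<close> is at most
      \<open>T + 1\<close>, so each summand is at most \<open>w\<close>.\<close>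
    moreover have "(\<Sum>j<T. (real j + 2)\<^sup>2) \<le> (\<Sum>j<T. w)"
      unfolding w_def by (intro sum_mono power_mono) auto
    then have "\<eta> * \<sigma>\<^sup>2 * (\<Sum>j<T. (real j + 2)\<^sup>2) \<le> \<eta> * \<sigma>\<^sup>2 * (real T * w)"
      using \<eta> by (intro mult_left_mono) auto
    ultimately show ?thesis
      by (simp add: C_def)
  qed
  finally show "(\<integral>x. F x \<partial>acsa d \<beta> \<gamma> G T) - F u \<le>
      3 * (norm u)\<^sup>2 / (\<eta> * (real T + 1)\<^sup>2) + \<eta> * \<sigma>\<^sup>2 * real T"
    using w \<eta> unfolding w_def[symmetric] by (simp add: field_simps)
qed

section \<open>Choice of the step size and the error bounds\<close>

text \<open>The parameters are fixed before dimension, objective and oracles, so they depend only on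
  \<open>H\<close>, \<open>B\<close>, \<open>\<sigma>\<close> and \<open>T\<close>. The oracle may
  change from one iteration to the next.\<close>

lemma acsa_rate:
  assumes "H > 0" "B > 0" "\<sigma> \<ge> 0" and T: "T \<ge> 1"
  shows "\<exists>\<beta> \<gamma>. acsa_parameters \<beta> \<gamma> \<and>
    (\<forall>d. \<forall>F\<in>objectives d H B. \<forall>G. (\<forall>t. gradient_oracle d F \<sigma> (G t)) \<longrightarrow>
       integrable (acsa d \<beta> \<gamma> G T) F \<and>
       (\<integral>x. F x \<partial>acsa d \<beta> \<gamma> G T) - min_value d F \<le>
         6 * (H * B\<^sup>2 / (real T)\<^sup>2 + \<sigma> * B / sqrt (real T)))"
proof -
  define q where "q = sqrt (real T)"
  have q: "q > 0" "real T = q\<^sup>2"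
    using T by (auto simp: q_def)
  \<comment> \<open>The summand \<open>2 * H\<close> secures the step size condition. The other is
    \<open>1 / \<eta>\<close> at the point where \<open>B\<^sup>2 / (\<eta> T\<^sup>2)\<close> and
    \<open>\<eta> \<sigma>\<^sup>2 T\<close> balance; with \<open>q\<close> the root of
    \<open>T\<close>, the power 3/2 becomes \<open>q ^ 3\<close>.\<close>
  define \<eta> where "\<eta> = 1 / (2 * H + \<sigma> * q ^ 3 / B)"
  have den: "2 * H + \<sigma> * q ^ 3 / B > 0"
    using assms q by (intro add_pos_nonneg) auto
  have \<eta>: "\<eta> > 0" "2 * H * \<eta> \<le> 1" "1 / \<eta> = 2 * H + \<sigma> * q ^ 3 / B"
    using den assms q by (auto simp: \<eta>_def field_simps)
  have noise: "\<eta> * \<sigma>\<^sup>2 * real T \<le> \<sigma> * B / q"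
  \<comment> \<open>The bound on \<open>\<eta>\<close> below divides by \<open>\<sigma>\<close>;
    without noise the claim is trivial.\<close>
  proof (cases "\<sigma> = 0")
    case False
    then have "\<eta> \<le> B / (\<sigma> * q ^ 3)"
      using assms q den unfolding \<eta>_def
      by (subst divide_le_eq) (auto simp: field_simps)
    then have "\<eta> * (\<sigma>\<^sup>2 * real T) \<le> B / (\<sigma> * q ^ 3) * (\<sigma>\<^sup>2 * real T)"
      by (rule mult_right_mono) simp
    also have "\<dots> = \<sigma> * B / q"
      using False q by (simp add: field_simps power2_eq_square power3_eq_cube)
    finally show ?thesis by simp
  qed simp
  define a b where "a = H * B\<^sup>2 / (real T)\<^sup>2" and "b = \<sigma> * B / q"
  have b: "b \<ge> 0"
    using assms q by (simp add: b_def)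
  define \<beta> where "\<beta> = (\<lambda>t::nat. (real t + 2) / 2)"
  define \<gamma> where "\<gamma> = (\<lambda>t::nat. \<eta> * (real t + 2) / 2)"
  have "acsa_parameters \<beta> \<gamma>"
    using \<eta> by (auto simp: acsa_parameters_def \<beta>_def \<gamma>_def)
  moreover have "integrable (acsa d \<beta> \<gamma> G T) F \<and>
       (\<integral>x. F x \<partial>acsa d \<beta> \<gamma> G T) - min_value d F \<le> 6 * (H * B\<^sup>2 / (real T)\<^sup>2 + \<sigma> * B / sqrt (real T))"
    if obj: "F \<in> objectives d H B" and G: "\<forall>t. gradient_oracle d F \<sigma> (G t)" for d F G
  proof -
    obtain u where F: "smooth d H F" "convex_on (euclid d) F" and u: "u \<in> euclid d" "norm u \<le> B"
      and min: "\<And>x. x \<in> euclid d \<Longrightarrow> F u \<le> F x"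
      using obj by (auto simp: objectives_def)
    have gap: "integrable (acsa d \<beta> \<gamma> G T) F"
      "(\<integral>x. F x \<partial>acsa d \<beta> \<gamma> G T) - F u \<le>
         3 * (norm u)\<^sup>2 / (\<eta> * (real T + 1)\<^sup>2) + \<eta> * \<sigma>\<^sup>2 * real T"
      unfolding \<beta>_def \<gamma>_def
      by (rule acsa_gap[OF F u(1) _ \<eta>(1,2)]; use G min in blast)+
    have "3 * (norm u)\<^sup>2 / (\<eta> * (real T + 1)\<^sup>2) \<le> 3 * B\<^sup>2 / (\<eta> * (real T)\<^sup>2)"
      using u \<eta> T by (intro frac_le mult_left_mono power_mono) auto
    also have "\<dots> = 3 * B\<^sup>2 * (1 / \<eta>) / (real T)\<^sup>2"
      by simp
    \<comment> \<open>The summand \<open>2 * H\<close> of \<open>1 / \<eta>\<close> yields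
      \<open>6 * a\<close>, the source of the constant 6; the noise term contributes one further
      \<open>b\<close>.\<close>
    also have "\<dots> = 6 * a + 3 * b"
      unfolding \<eta>(3) a_def b_def using q assms
      by (simp add: field_simps power2_eq_square power3_eq_cube)
    finally have "(\<integral>x. F x \<partial>acsa d \<beta> \<gamma> G T) - F u \<le> 6 * a + 3 * b + b"
      using noise unfolding b_def[symmetric] by (intro order_trans[OF gap(2)] add_mono)
    also have "6 * a + 3 * b + b \<le> 6 * (a + b)"
      using b by simp
    also have "F u = min_value d F"
      by (rule min_value_eq[OF u(1), symmetric]) (rule min)
    finally show ?thesis
      using gap(1) by (simp add: a_def b_def q_def)
  qed
  ultimately show ?thesis by blast
qed

text \<open>The output is the starting point 0, at distance at most \<open>B\<close> from a
  minimizer, so smoothness alone bounds its gap.\<close>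

lemma acsa_constant:
  assumes obj: "F \<in> objectives d H B" and "H > 0"
    and G: "\<And>t. gradient_oracle d F \<sigma> (G t)"
  shows "integrable (acsa d (\<lambda>_. 1) (\<lambda>_. 0) G T) F"
    and "(\<integral>x. F x \<partial>acsa d (\<lambda>_. 1) (\<lambda>_. 0) G T) - min_value d F \<le> H * B\<^sup>2"
proof -
  obtain u where F: "smooth d H F" and u: "u \<in> euclid d" "norm u \<le> B"
    and min: "\<And>x. x \<in> euclid d \<Longrightarrow> F u \<le> F x"
    using obj by (auto simp: objectives_def)
  have meas: "F \<in> borel_measurable (borel_euclid d)"
    by (rule continuous_on_imp_measurable_borel_euclid[OF smooth_continuous_on[OF F]])
  have acsa: "acsa d (\<lambda>_. 1) (\<lambda>_. 0) G T = return (borel_euclid d) 0"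
    unfolding acsa_def acsa_state_constant[OF gradient_oracle_kernel[OF G]]
    by (subst distr_return) (auto simp: space_states)
  have "integrable (return (borel_euclid d) 0) F"
    using meas by (intro integrableI_bounded) (auto simp: nn_integral_return)
  then show "integrable (acsa d (\<lambda>_. 1) (\<lambda>_. 0) G T) F"
    unfolding acsa .
  have "F 0 - F u \<le> H / 2 * (norm u)\<^sup>2"
    using smooth_minimum_gap[OF F u(1) min zero_in_euclid] by simp
  also have "\<dots> \<le> H * B\<^sup>2"
    using u \<open>H > 0\<close> by (intro mult_mono power_mono) auto
  finally have "F 0 - F u \<le> H * B\<^sup>2" .
  moreover have "min_value d F = F u"
    by (rule min_value_eq[OF u(1)]) (rule min)
  ultimately show "(\<integral>x. F x \<partial>acsa d (\<lambda>_. 1) (\<lambda>_. 0) G T) - min_value d F \<le> H * B\<^sup>2"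
    unfolding acsa using meas by (simp add: integral_return)
qed

theorem theorem12:
  "\<exists>c::real. c > 0 \<and>
     (\<forall>(M::nat) (K::nat) (R::nat) (H::real) (B::real) (\<sigma>::real).
        M \<ge> 1 \<longrightarrow> K \<ge> 1 \<longrightarrow> R \<ge> 1 \<longrightarrow> H > 0 \<longrightarrow> B > 0 \<longrightarrow> \<sigma> \<ge> 0 \<longrightarrow>
        (let \<epsilon> = c * Min {H * B\<^sup>2 / (real (K * R))\<^sup>2 + \<sigma> * B / sqrt (real (K * R)),
                          H * B\<^sup>2 / (real R)\<^sup>2 + \<sigma> * B / sqrt (real (M * K * R)),
                          H * B\<^sup>2}
         in (\<exists>\<beta> \<gamma>. acsa_parameters \<beta> \<gamma> \<and>
                    guarantees (minibatch_acsa M K R \<beta> \<gamma>) H B \<sigma> \<epsilon>) \<or>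
            (\<exists>\<beta> \<gamma>. acsa_parameters \<beta> \<gamma> \<and>
                    guarantees (single_machine_acsa K R \<beta> \<gamma>) H B \<sigma> \<epsilon>)))"
proof (intro exI[of _ 6] conjI allI impI)
  fix M K R :: nat and H B \<sigma> :: real
  assume MKR: "M \<ge> 1" "K \<ge> 1" "R \<ge> 1" and HB: "H > 0" "B > 0" "\<sigma> \<ge> 0"
  let ?s = "H * B\<^sup>2 / (real (K * R))\<^sup>2 + \<sigma> * B / sqrt (real (K * R))"
  let ?m = "H * B\<^sup>2 / (real R)\<^sup>2 + \<sigma> * B / sqrt (real (M * K * R))"
  let ?c = "H * B\<^sup>2"
  let ?minibatch = "\<lambda>\<epsilon>. \<exists>\<beta> \<gamma>. acsa_parameters \<beta> \<gamma> \<and>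
    guarantees (minibatch_acsa M K R \<beta> \<gamma>) H B \<sigma> \<epsilon>"
  let ?single = "\<lambda>\<epsilon>. \<exists>\<beta> \<gamma>. acsa_parameters \<beta> \<gamma> \<and>
    guarantees (single_machine_acsa K R \<beta> \<gamma>) H B \<sigma> \<epsilon>"
  have "?single (6 * ?s)"
  proof -
    \<comment> \<open>The rate for \<open>T = K * R\<close> iterations, each served by the oracle of
      its own query on machine 0.\<close>
    obtain \<beta> \<gamma> where params: "acsa_parameters \<beta> \<gamma>" and rate:
      "\<And>d F G. F \<in> objectives d H B \<Longrightarrow> \<forall>t. gradient_oracle d F \<sigma> (G t) \<Longrightarrow>
         integrable (acsa d \<beta> \<gamma> G (K * R)) F \<and>
         (\<integral>x. F x \<partial>acsa d \<beta> \<gamma> G (K * R)) - min_value d F \<le> 6 * ?s"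
      using acsa_rate[OF HB, of "K * R"] MKR by (auto simp: Suc_le_eq)
    have "guarantees (single_machine_acsa K R \<beta> \<gamma>) H B \<sigma> (6 * ?s)"
      unfolding guarantees_def single_machine_acsa_def
      by (intro allI ballI impI rate) (simp_all add: oracles_for_def)
    with params show ?thesis by blast
  qed
  moreover have "?minibatch (6 * ?m)"
  proof -
    \<comment> \<open>The noise level of a round average, so that \<open>R\<close> iterations give
      the root of \<open>M * K * R\<close> in the denominator.\<close>
    define \<tau> where "\<tau> = \<sigma> / sqrt (real (M * K))"
    have \<tau>: "\<tau> \<ge> 0" "\<tau> * B / sqrt (real R) = \<sigma> * B / sqrt (real (M * K * R))"
      using HB by (simp_all add: \<tau>_def real_sqrt_mult)
    obtain \<beta> \<gamma> where params: "acsa_parameters \<beta> \<gamma>" and rate: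
      "\<And>d F G. F \<in> objectives d H B \<Longrightarrow> \<forall>t. gradient_oracle d F \<tau> (G t) \<Longrightarrow>
         integrable (acsa d \<beta> \<gamma> G R) F \<and>
         (\<integral>x. F x \<partial>acsa d \<beta> \<gamma> G R) - min_value d F \<le> 6 * ?m"
      using acsa_rate[OF HB(1,2) \<tau>(1) MKR(3)] unfolding \<tau>(2) by blast
    have "guarantees (minibatch_acsa M K R \<beta> \<gamma>) H B \<sigma> (6 * ?m)"
      unfolding guarantees_def minibatch_acsa_def
    proof (intro allI ballI impI)
      fix d F Q assume F: "F \<in> objectives d H B" and Q: "oracles_for d F \<sigma> Q"
      from F have "smooth d H F" by (simp add: objectives_def)
      from round_average_gradient_oracle[OF this Q MKR(1,2)]
      show "integrable (acsa d \<beta> \<gamma> (round_average d M K Q) R) F \<and>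
          (\<integral>x. F x \<partial>acsa d \<beta> \<gamma> (round_average d M K Q) R) - min_value d F \<le> 6 * ?m"
        by (intro rate[OF F]) (simp add: \<tau>_def)
    qed
    with params show ?thesis by blast
  qed
  moreover have "?single (6 * ?c)"
  proof -
    have "guarantees (single_machine_acsa K R (\<lambda>_. 1) (\<lambda>_. 0)) H B \<sigma> (6 * ?c)"
      unfolding guarantees_def single_machine_acsa_def
    proof (intro allI ballI impI conjI)
      fix d F Q assume F: "F \<in> objectives d H B" and Q: "oracles_for d F \<sigma> Q"
      let ?A = "acsa d (\<lambda>_. 1) (\<lambda>_. 0) (\<lambda>t. Q (t div K) 0 (t mod K)) (K * R)"
      have G: "gradient_oracle d F \<sigma> (Q (t div K) 0 (t mod K))" for t
        using Q by (simp add: oracles_for_def)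
      show "integrable ?A F"
        by (rule acsa_constant(1)[OF F HB(1) G])
      have "(\<integral>x. F x \<partial>?A) - min_value d F \<le> ?c"
        by (rule acsa_constant(2)[OF F HB(1) G])
      also have "\<dots> \<le> 6 * ?c"
        using HB by simp
      finally show "(\<integral>x. F x \<partial>?A) - min_value d F \<le> 6 * ?c" .
    qed
    moreover have "acsa_parameters (\<lambda>_. 1) (\<lambda>_. 0)"
      by (simp add: acsa_parameters_def)
    ultimately show ?thesis by blast
  qed
  \<comment> \<open>The minimum is attained by one of the three terms, and that term selects the
    algorithm and its parameters.\<close>
  moreover have "Min {?s, ?m, ?c} \<in> {?s, ?m, ?c}"
    by (rule Min_in) auto
  ultimately show "let \<epsilon> = 6 * Min {?s, ?m, ?c} in ?minibatch \<epsilon> \<or> ?single \<epsilon>"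
    unfolding Let_def by (elim insertE emptyE) metis+
qed simp

end
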